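(* Let $n$ be a positive integer. Let $P$ be a set of $n$ points in general position in the plane $\mathbb{R}^2$, and let $R$ be another set of $n$ points in the plane, disjoint from $P$. Suppose that for every two distinct points $x,y \in P$ there is a point $r \in R$ that lies on the line through $x$ and $y$ and outside the segment with endpoints $x$ and $y$. Then $P \cup R$ is contained in a cubic curve.
   Context: A set of points in the plane is in general position if no three of its points are collinear. A cubic curve is the zero set in the plane of a nonzero real polynomial in two variables of degree at most $3$; it may be reducible (for example, a union of a conic and a line, or of three lines). *)

theory Defs
  imports "HOL-Analysis.Analysis" "HOL-Computational_Algebra.Polynomial"
begin

definition general_position :: "(real ^ 2) set \<Rightarrow> bool" where
  "general_position P \<longleftrightarrow>
     (\<forall>x\<in>P. \<forall>y\<in>P. \<forall>z\<in>P. x \<noteq> y \<and> x \<noteq> z \<and> y \<noteq> z \<longrightarrow> \<not> collinear {x, y, z})"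

text \<open>
  Real polynomials in two variables X, Y are elements of R[X][Y], that is, of type
  \<^typ>\<open>real poly poly\<close>: the coefficient of X^i Y^j in f is \<^term>\<open>coeff (coeff f j) i\<close>.
\<close>

definition total_degree_le :: "'a::zero poly poly \<Rightarrow> nat \<Rightarrow> bool" where
  "total_degree_le f d \<longleftrightarrow> (\<forall>i j. coeff (coeff f j) i \<noteq> 0 \<longrightarrow> i + j \<le> d)"

definition eval2 :: "real poly poly \<Rightarrow> real ^ 2 \<Rightarrow> real" where
  "eval2 f v = poly (poly f [:v $ 2:]) (v $ 1)"

definition cubic_curve :: "(real ^ 2) set \<Rightarrow> bool" where
  "cubic_curve C \<longleftrightarrow> (\<exists>f. f \<noteq> 0 \<and> total_degree_le f 3 \<and> C = {v. eval2 f v = 0})"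

end

theory Submission
  imports Defs
begin

text \<open>
  Sort the bipartitions of \<open>P\<close> cut out by lines (\<open>cells\<close>) by the points \<open>r \<in> R\<close> whose lines realise
  them. A line turning around \<open>r\<close> changes its bipartition only when it meets \<open>P\<close>, and two points
  of \<open>P\<close> collinear with \<open>r\<close> are met simultaneously; so the blocking condition bounds the total number
  of (point, bipartition) incidences by \<open>(n + 1 choose 2)\<close>. Shifting the lines through two points of
  \<open>P\<close> slightly to either side gives at least \<open>(n choose 2)\<close> nontrivial bipartitions, and each of them is
  realised by a line through the blocking point, because that point is outside the segment. Any two
  points of \<open>R\<close> share the bipartition given by their common line, so a point of \<open>R\<close> all of whose
  bipartitions are nontrivial would produce too many incidences. Hence every point of \<open>R\<close> lies
  outside the convex hull of \<open>P\<close>, and every pair of \<open>P\<close> is blocked exactly once.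

  Counting the two tangents from each point of \<open>R\<close> to the hull then forces \<open>P\<close> to be in convex
  position, and forces the points of \<open>P\<close> to be seen from each point of \<open>R\<close> in pairs, except for tangent
  points. So in the cyclic order \<open>p\<^sub>0, \<dots>, p\<^sub>n\<^sub>-\<^sub>1\<close> the blocking point of \<open>p\<^sub>i\<close> and \<open>p\<^sub>j\<close> depends only on
  \<open>i + j\<close> modulo \<open>n\<close>, and the Cayley-Bacharach theorem, applied to hexagons of points
  of \<open>P\<close> whose opposite sides meet in \<open>R\<close>, propagates a cubic through nine of the points to all of
  them.
\<close>

subsection \<open>Polynomials vanishing on lines and the Cayley-Bacharach theorem\<close>

definition det2 :: "real ^ 2 \<Rightarrow> real ^ 2 \<Rightarrow> real" where
  "det2 u w = u $ 1 * w $ 2 - u $ 2 * w $ 1"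

definition det3 :: "real ^ 2 \<Rightarrow> real ^ 2 \<Rightarrow> real ^ 2 \<Rightarrow> real" where
  "det3 a b c = det2 (b - a) (c - a)"

lemma vec2_eq_iff: "(x :: real ^ 2) = y \<longleftrightarrow> x $ 1 = y $ 1 \<and> x $ 2 = y $ 2"
  by (simp add: vec_eq_iff forall_2)

lemma inner2: "(x :: real ^ 2) \<bullet> y = x $ 1 * y $ 1 + x $ 2 * y $ 2"
  by (simp add: inner_vec_def sum_2)

lemma det3_alt: "det3 a b c = (b $ 1 - a $ 1) * (c $ 2 - a $ 2) - (b $ 2 - a $ 2) * (c $ 1 - a $ 1)"
  by (simp add: det3_def det2_def)

lemma det3_rotate: "det3 a b c = det3 b c a"
  by (simp add: det3_alt algebra_simps)

lemma det3_swap: "det3 a c b = - det3 a b c"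
  by (simp add: det3_alt algebra_simps)

lemma det3_same [simp]: "det3 a a b = 0" "det3 a b a = 0" "det3 b a a = 0"
  by (simp_all add: det3_alt)

lemma det3_eq_0_perm:
  assumes "det3 a b c = 0"
  shows "det3 a c b = 0" "det3 b a c = 0" "det3 b c a = 0" "det3 c a b = 0" "det3 c b a = 0"
  using assms by (simp_all add: det3_alt algebra_simps)

lemma det3_line_unique:
  assumes "det3 a b x = 0" "det3 a b y = 0" "a \<noteq> b"
  shows "det3 a x y = 0"
proof -
  have "(b $ 1 - a $ 1) * det3 a x y = 0" "(b $ 2 - a $ 2) * det3 a x y = 0"
    using assms(1,2) unfolding det3_alt by algebra+
  then show ?thesis
    using assms(3) by (auto simp: vec2_eq_iff)
qed

lemma det3_common_line:
  assumes "det3 a b x = 0" "det3 a b y = 0" "det3 a b z = 0" "a \<noteq> b"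
  shows "det3 x y z = 0"
proof -
  have "(b $ 1 - a $ 1) * det3 x y z = 0" "(b $ 2 - a $ 2) * det3 x y z = 0"
    using assms(1-3) unfolding det3_alt by algebra+
  then show ?thesis
    using assms(4) by (auto simp: vec2_eq_iff)
qed

lemma det3_imp_collinear:
  assumes "det3 a b c = 0" shows "collinear {a, b, c}"
proof (cases "a = b")
  case False
  define t where "t = ((c - a) \<bullet> (b - a)) / ((b - a) \<bullet> (b - a))"
  have nz: "(b - a) \<bullet> (b - a) \<noteq> 0" using False by simp
  have "((b - a) \<bullet> (b - a)) *\<^sub>R (c - a) = ((c - a) \<bullet> (b - a)) *\<^sub>R (b - a)"
    using assms by (simp add: vec2_eq_iff inner2 det3_alt) algebra
  then have "((b - a) \<bullet> (b - a)) *\<^sub>R (c - a) = ((b - a) \<bullet> (b - a)) *\<^sub>R (t *\<^sub>R (b - a))"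
    using nz by (simp add: t_def)
  then have "c - a = t *\<^sub>R (b - a)"
    using nz by (metis scaleR_left_imp_eq)
  then have c: "c = a + t *\<^sub>R (b - a)" by (simp add: algebra_simps)
  show ?thesis
    unfolding collinear_alt
    by (rule exI[of _ a], rule exI[of _ "b - a"])
      (use c in \<open>auto intro: exI[of _ 0] exI[of _ 1] exI[of _ t]\<close>)
qed (simp add: collinear_2)

text \<open>Polynomial functions of degree at most \<open>d\<close> in a two-variable Horner form.
  \<open>G\<close> and \<open>H\<close> are not unique, but the form turns division by a line into
  an induction on \<open>d\<close> at the level of functions.\<close>

fun polyfun :: "nat \<Rightarrow> (real ^ 2 \<Rightarrow> real) \<Rightarrow> bool" where
  "polyfun 0 F \<longleftrightarrow> (\<exists>c. F = (\<lambda>v. c))"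
| "polyfun (Suc d) F \<longleftrightarrow>
     (\<exists>G H c. polyfun d G \<and> polyfun d H \<and> F = (\<lambda>v. c + v $ 1 * G v + v $ 2 * H v))"

lemma polyfun_SucI:
  assumes "polyfun d G" "polyfun d H" "\<And>v. F v = c + v $ 1 * G v + v $ 2 * H v"
  shows "polyfun (Suc d) F"
  using assms by (auto simp: fun_eq_iff)

lemma polyfun_const: "polyfun d (\<lambda>v. c)"
proof (induction d arbitrary: c)
  case 0
  show ?case by auto
next
  case (Suc d)
  show ?case by (rule polyfun_SucI[OF Suc[of 0] Suc[of 0], of _ c]) simp
qed

lemma polyfun_add:
  assumes "polyfun d F" "polyfun d G" shows "polyfun d (\<lambda>v. F v + G v)"
  using assms
proof (induction d arbitrary: F G)
  case (Suc d)
  from Suc.prems obtain A B c A' B' c' where *: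
    "polyfun d A" "polyfun d B" "F = (\<lambda>v. c + v $ 1 * A v + v $ 2 * B v)"
    "polyfun d A'" "polyfun d B'" "G = (\<lambda>v. c' + v $ 1 * A' v + v $ 2 * B' v)"
    by auto
  show ?case
    by (rule polyfun_SucI[OF Suc.IH[OF *(1,4)] Suc.IH[OF *(2,5)], of _ "c + c'"])
      (simp add: * algebra_simps)
qed auto

lemma polyfun_scale:
  assumes "polyfun d F" shows "polyfun d (\<lambda>v. a * F v)"
  using assms
proof (induction d arbitrary: F)
  case (Suc d)
  from Suc.prems obtain A B c where *:
    "polyfun d A" "polyfun d B" "F = (\<lambda>v. c + v $ 1 * A v + v $ 2 * B v)"
    by auto
  show ?case
    by (rule polyfun_SucI[OF Suc.IH[OF *(1)] Suc.IH[OF *(2)], of _ "a * c"])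
      (simp add: * algebra_simps)
qed auto

lemma polyfun_Suc: "polyfun d F \<Longrightarrow> polyfun (Suc d) F"
proof (induction d arbitrary: F)
  case 0
  then obtain c where "F = (\<lambda>v. c)" by auto
  then show ?case using polyfun_const[of "Suc 0" c] by simp
next
  case (Suc d)
  from Suc.prems obtain A B c where
    "polyfun d A" "polyfun d B" "F = (\<lambda>v. c + v $ 1 * A v + v $ 2 * B v)"
    by auto
  then show ?case using Suc.IH[of A] Suc.IH[of B] by (metis polyfun.simps(2))
qed

lemma polyfun_coord:
  assumes "polyfun d F"
  shows "polyfun (Suc d) (\<lambda>v. v $ 1 * F v)" "polyfun (Suc d) (\<lambda>v. v $ 2 * F v)"
proof -
  show "polyfun (Suc d) (\<lambda>v. v $ 1 * F v)"
    unfolding polyfun.simps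
    by (rule exI[of _ F], rule exI[of _ "\<lambda>v. 0"], rule exI[of _ 0]) (auto simp: assms polyfun_const)
  show "polyfun (Suc d) (\<lambda>v. v $ 2 * F v)"
    unfolding polyfun.simps
    by (rule exI[of _ "\<lambda>v. 0"], rule exI[of _ F], rule exI[of _ 0]) (auto simp: assms polyfun_const)
qed

lemma polyfun_affine_mult:
  assumes "polyfun d F"
  shows "polyfun (Suc d) (\<lambda>v. (a + b * v $ 1 + c * v $ 2) * F v)"
proof -
  have "polyfun (Suc d) (\<lambda>v. a * F v + (b * (v $ 1 * F v) + c * (v $ 2 * F v)))"
    by (intro polyfun_add polyfun_scale polyfun_coord polyfun_Suc assms)
  then show ?thesis by (simp add: algebra_simps)
qed

lemma polyfun_affine: "polyfun (Suc 0) (\<lambda>v. a + b * v $ 1 + c * v $ 2)"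
  using polyfun_affine_mult[OF polyfun_const[of 0 1], of a b c] by (simp del: polyfun.simps)

lemma polyfun_det3_mult:
  assumes "polyfun d F"
  shows "polyfun (Suc d) (\<lambda>v. det3 a b v * F v)"
  using polyfun_affine_mult[OF assms, of "(b $ 2 - a $ 2) * a $ 1 - (b $ 1 - a $ 1) * a $ 2"
      "- (b $ 2 - a $ 2)" "b $ 1 - a $ 1"]
  by (simp add: det3_alt algebra_simps)

lemma polyfun_poly_affine:
  assumes "degree p \<le> d"
  shows "polyfun d (\<lambda>v. poly p (a + b * v $ 1 + c * v $ 2))"
  using assms
proof (induction p arbitrary: d)
  case 0
  then show ?case by (simp add: polyfun_const)
next
  case (pCons e p)
  show ?case
  proof (cases "p = 0")
    case True
    then show ?thesis by (simp add: polyfun_const)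
  next
    case False
    then obtain d' where d': "d = Suc d'" "degree p \<le> d'"
      using pCons.prems by (cases d) auto
    have "polyfun (Suc d') (\<lambda>v. e + (a + b * v $ 1 + c * v $ 2) * poly p (a + b * v $ 1 + c * v $ 2))"
      by (intro polyfun_add polyfun_const polyfun_affine_mult pCons.IH d')
    then show ?thesis by (simp add: d')
  qed
qed

text \<open>This splits \<open>v - a\<close> along \<open>b - a\<close> and along the perpendicular
  direction. The component across the line \<open>ab\<close> is a multiple of
  \<open>det3 a b v\<close>, which is what allows this factor to be split off a polynomial.\<close>

lemma frame_coordinates:
  fixes a b v :: "real ^ 2"
  assumes "a \<noteq> b"
  defines "N \<equiv> (b - a) \<bullet> (b - a)" and "s \<equiv> (v - a) \<bullet> (b - a)"
  shows "v $ 1 = a $ 1 + s / N * (b $ 1 - a $ 1) - det3 a b v * ((b $ 2 - a $ 2) / N)"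
    and "v $ 2 = a $ 2 + s / N * (b $ 2 - a $ 2) + det3 a b v * ((b $ 1 - a $ 1) / N)"
proof -
  have N: "N \<noteq> 0" using assms(1) by (simp add: N_def)
  have "N * v $ 1 = N * a $ 1 + s * (b $ 1 - a $ 1) - det3 a b v * (b $ 2 - a $ 2)"
    by (simp add: N_def s_def inner2 det3_alt algebra_simps)
  then have "v $ 1 = (N * a $ 1 + s * (b $ 1 - a $ 1) - det3 a b v * (b $ 2 - a $ 2)) / N"
    using N by (simp add: eq_divide_eq mult.commute)
  then show "v $ 1 = a $ 1 + s / N * (b $ 1 - a $ 1) - det3 a b v * ((b $ 2 - a $ 2) / N)"
    using N by (simp add: add_divide_distrib diff_divide_distrib algebra_simps)
  have "N * v $ 2 = N * a $ 2 + s * (b $ 2 - a $ 2) + det3 a b v * (b $ 1 - a $ 1)"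
    by (simp add: N_def s_def inner2 det3_alt algebra_simps)
  then have "v $ 2 = (N * a $ 2 + s * (b $ 2 - a $ 2) + det3 a b v * (b $ 1 - a $ 1)) / N"
    using N by (simp add: eq_divide_eq mult.commute)
  then show "v $ 2 = a $ 2 + s / N * (b $ 2 - a $ 2) + det3 a b v * ((b $ 1 - a $ 1) / N)"
    using N by (simp add: add_divide_distrib diff_divide_distrib algebra_simps)
qed

text \<open>Modulo the equation of the line \<open>ab\<close>, a polynomial is univariate in a coordinate \<open>t\<close> along it.\<close>
lemma polyfun_divide:
  assumes "a \<noteq> b" "polyfun (Suc d) F"
  defines "t \<equiv> (\<lambda>v. ((v - a) \<bullet> (b - a)) / ((b - a) \<bullet> (b - a)))"
  shows "\<exists>G p. polyfun d G \<and> degree p \<le> Suc d \<and> (\<forall>v. F v = det3 a b v * G v + poly p (t v))"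
  using assms(2)
proof (induction d arbitrary: F)
  case 0
  define N where "N = (b - a) \<bullet> (b - a)"
  have N: "N \<noteq> 0" using assms(1) by (simp add: N_def)
  obtain c g h where F: "F = (\<lambda>v. c + v $ 1 * g + v $ 2 * h)"
    using 0 by auto
  have x: "v $ 1 = a $ 1 + t v * (b $ 1 - a $ 1) - det3 a b v * ((b $ 2 - a $ 2) / N)"
   and y: "v $ 2 = a $ 2 + t v * (b $ 2 - a $ 2) + det3 a b v * ((b $ 1 - a $ 1) / N)" for v
    using frame_coordinates[OF assms(1), of v] unfolding t_def N_def by auto
  show ?case
  proof (intro exI conjI allI)
    show "polyfun 0 (\<lambda>v. (h * (b $ 1 - a $ 1) - g * (b $ 2 - a $ 2)) / N)"
      by auto
    show "degree [:c + a $ 1 * g + a $ 2 * h, (b $ 1 - a $ 1) * g + (b $ 2 - a $ 2) * h:] \<le> Suc 0"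
      by simp
    show "F v = det3 a b v * ((h * (b $ 1 - a $ 1) - g * (b $ 2 - a $ 2)) / N) +
       poly [:c + a $ 1 * g + a $ 2 * h, (b $ 1 - a $ 1) * g + (b $ 2 - a $ 2) * h:] (t v)" for v
      unfolding F by (subst x, subst y) (use N in \<open>simp add: field_simps\<close>)
  qed
next
  case (Suc d)
  define N where "N = (b - a) \<bullet> (b - a)"
  have N: "N \<noteq> 0" using assms(1) by (simp add: N_def)
  have x: "v $ 1 = a $ 1 + t v * (b $ 1 - a $ 1) - det3 a b v * ((b $ 2 - a $ 2) / N)"
   and y: "v $ 2 = a $ 2 + t v * (b $ 2 - a $ 2) + det3 a b v * ((b $ 1 - a $ 1) / N)" for v
    using frame_coordinates[OF assms(1), of v] unfolding t_def N_def by auto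
  obtain G H c where GH: "polyfun (Suc d) G" "polyfun (Suc d) H"
    and F: "F = (\<lambda>v. c + v $ 1 * G v + v $ 2 * H v)"
    using Suc.prems by (subst (asm) polyfun.simps(2)) blast
  obtain G' p where G': "polyfun d G'" "degree p \<le> Suc d"
    "\<And>v. G v = det3 a b v * G' v + poly p (t v)"
    using Suc.IH[OF GH(1)] by blast
  obtain H' q where H': "polyfun d H'" "degree q \<le> Suc d"
    "\<And>v. H v = det3 a b v * H' v + poly q (t v)"
    using Suc.IH[OF GH(2)] by blast
  have t_affine: "t v = - ((a \<bullet> (b - a)) / N) + (b $ 1 - a $ 1) / N * v $ 1 + (b $ 2 - a $ 2) / N * v $ 2" for v
    using N unfolding t_def N_def[symmetric] by (simp add: field_simps inner2)
  have pol: "polyfun (Suc d) (\<lambda>v. poly p (t v))" if "degree p \<le> Suc d" for p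
    unfolding t_affine by (rule polyfun_poly_affine[OF that])
  \<comment> \<open>Substituting the frame coordinates for \<open>v $ 1\<close> and
    \<open>v $ 2\<close> in front of the univariate remainders leaves further multiples of the line,
    which go into \<open>K\<close>, and polynomials in \<open>t v\<close>, which go into
    \<open>s\<close>.\<close>
  define K where "K v = (v $ 1 * G' v + - ((b $ 2 - a $ 2) / N) * poly p (t v))
    + (v $ 2 * H' v + (b $ 1 - a $ 1) / N * poly q (t v))" for v
  define s where "s = [:c:] + [:a $ 1, b $ 1 - a $ 1:] * p + [:a $ 2, b $ 2 - a $ 2:] * q"
  show ?case
  proof (intro exI conjI allI)
    show "polyfun (Suc d) K"
      unfolding K_def by (intro polyfun_add polyfun_coord polyfun_scale G' H' pol)
    have d: "degree ([:x, y:] * p') \<le> Suc (Suc d)" if "degree p' \<le> Suc d" for x y :: real and p'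
      using degree_mult_le[of "[:x, y:]" p'] that by (simp split: if_splits)
    show "degree s \<le> Suc (Suc d)"
      unfolding s_def by (intro degree_add_le d G' H') simp
    show "F v = det3 a b v * K v + poly s (t v)" for v
    proof -
      have "F v = c + v $ 1 * (det3 a b v * G' v) + v $ 2 * (det3 a b v * H' v)
          + v $ 1 * poly p (t v) + v $ 2 * poly q (t v)"
        by (simp add: F G'(3) H'(3) algebra_simps)
      also have "v $ 1 * poly p (t v) = (a $ 1 + t v * (b $ 1 - a $ 1)) * poly p (t v)
         - det3 a b v * ((b $ 2 - a $ 2) / N) * poly p (t v)"
        by (subst x) (simp add: algebra_simps)
      also have "v $ 2 * poly q (t v) = (a $ 2 + t v * (b $ 2 - a $ 2)) * poly q (t v)
         + det3 a b v * ((b $ 1 - a $ 1) / N) * poly q (t v)"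
        by (subst y) (simp add: algebra_simps)
      finally show ?thesis by (simp add: K_def s_def algebra_simps)
    qed
  qed
qed

lemma line_coordinate:
  assumes "a \<noteq> b" "det3 a b v = 0"
  shows "v = a + (((v - a) \<bullet> (b - a)) / ((b - a) \<bullet> (b - a))) *\<^sub>R (b - a)"
  using frame_coordinates[OF assms(1), of v] assms(2) by (simp add: vec2_eq_iff)

text \<open>On the line \<open>ab\<close> the function is a univariate polynomial of degree at most
  \<open>Suc d\<close> in a coordinate that is injective there, so more than \<open>Suc d\<close>
  zeros force the remainder to vanish.\<close>

lemma polyfun_factor:
  assumes "a \<noteq> b" "polyfun (Suc d) F"
    and S: "finite S" "card S > Suc d" "\<And>v. v \<in> S \<Longrightarrow> det3 a b v = 0 \<and> F v = 0"
  obtains G where "polyfun d G" "\<And>v. F v = det3 a b v * G v"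
proof -
  define t where "t = (\<lambda>v. ((v - a) \<bullet> (b - a)) / ((b - a) \<bullet> (b - a)))"
  obtain G p where G: "polyfun d G" "degree p \<le> Suc d" "\<And>v. F v = det3 a b v * G v + poly p (t v)"
    using polyfun_divide[OF assms(1,2)] unfolding t_def by blast
  have "p = 0"
  proof (rule ccontr)
    assume "p \<noteq> 0"
    have inj: "inj_on t S"
      using line_coordinate[OF assms(1)] S(3) unfolding t_def inj_on_def by metis
    have "t ` S \<subseteq> {x. poly p x = 0}"
      using G(3) S(3) by fastforce
    then have "card S \<le> card {x. poly p x = 0}"
      using inj poly_roots_finite[OF \<open>p \<noteq> 0\<close>] by (metis card_image card_mono)
    also have "\<dots> \<le> Suc d" using card_poly_roots_bound[OF \<open>p \<noteq> 0\<close>] G(2) by simp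
    finally show False using S(2) by simp
  qed
  then show thesis using that G by simp
qed

definition gp3 :: "(real ^ 2) set \<Rightarrow> bool" where
  "gp3 P \<longleftrightarrow> (\<forall>x\<in>P. \<forall>y\<in>P. \<forall>z\<in>P. x \<noteq> y \<longrightarrow> x \<noteq> z \<longrightarrow> y \<noteq> z \<longrightarrow> det3 x y z \<noteq> 0)"

lemma gp3D:
  "gp3 P \<Longrightarrow> x \<in> P \<Longrightarrow> y \<in> P \<Longrightarrow> z \<in> P \<Longrightarrow> x \<noteq> y \<Longrightarrow> x \<noteq> z \<Longrightarrow> y \<noteq> z \<Longrightarrow> det3 x y z \<noteq> 0"
  by (simp add: gp3_def)

lemma general_position_gp3: "general_position P \<Longrightarrow> gp3 P"
  unfolding general_position_def gp3_def using det3_imp_collinear by blast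

text \<open>Used contrapositively: for distinct \<open>x\<close>, \<open>y\<close>, \<open>z\<close>
  in general position the lines \<open>xy\<close> and \<open>zw\<close> meet at most once.\<close>

lemma lines_share_two_points:
  assumes "det3 x y p = 0" "det3 x y q = 0" "det3 z w p = 0" "det3 z w q = 0"
    "x \<noteq> y" "z \<noteq> w" "p \<noteq> q"
  shows "det3 x y z = 0"
proof -
  have "det3 p q x = 0" "det3 p q y = 0" "det3 p q z = 0"
    using det3_common_line[OF assms(1,2) _ assms(5)] det3_common_line[OF assms(3,4) _ assms(6)] by auto
  then show ?thesis using det3_common_line assms(7) by blast
qed

lemma lines_corner:
  assumes "det3 a b w = 0" "det3 b c w = 0" "w \<noteq> b"
  shows "det3 a b c = 0"
  using det3_line_unique[of b w a c] det3_eq_0_perm[OF assms(1)] det3_eq_0_perm[OF assms(2)] assms(3)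
    det3_eq_0_perm by metis

lemma line_other_point:
  assumes "a \<noteq> b" "finite X"
  obtains w where "det3 a b w = 0" "w \<notin> X"
proof -
  define g where "g = (\<lambda>k :: nat. a + real k *\<^sub>R (b - a))"
  have "inj g" using assms(1) by (auto simp: g_def inj_def)
  then have "infinite (range g)" by (rule range_inj_infinite)
  then obtain k where "g k \<notin> X" using assms(2) by (meson finite_subset image_subsetI)
  moreover have "det3 a b (g k) = 0" by (simp add: g_def det3_alt algebra_simps)
  ultimately show thesis using that by blast
qed

lemma polyfun_lines3: "polyfun 3 (\<lambda>v. det3 a b v * (det3 c d v * det3 e f v))"
proof -
  have "polyfun (Suc (Suc (Suc 0))) (\<lambda>v. det3 a b v * (det3 c d v * (det3 e f v * 1)))"
    by (intro polyfun_det3_mult polyfun_const)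
  then show ?thesis by (simp add: numeral_3_eq_3 del: polyfun.simps)
qed

text \<open>If \<open>F\<close> has three zeros on \<open>ab\<close>, a suitable multiple of \<open>H\<close> creates a fourth one.\<close>
lemma cubic_split_line:
  assumes "polyfun 3 F" "polyfun 3 H" "a \<noteq> b"
    and zero: "det3 a b c = 0" "distinct [a, b, c]" "F a = 0" "F b = 0" "F c = 0"
      "H a = 0" "H b = 0" "H c = 0"
    and H: "\<And>w. det3 a b w = 0 \<Longrightarrow> H w = 0 \<Longrightarrow> w \<in> {a, b, c}"
  obtains \<beta> Q where "polyfun 2 Q" "\<And>v. F v = \<beta> * H v + det3 a b v * Q v"
proof -
  obtain w where w: "det3 a b w = 0" "w \<notin> {a, b, c}"
    using line_other_point[OF assms(3), of "{a, b, c}"] by auto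
  then have "H w \<noteq> 0" using H by blast
  define \<beta> where "\<beta> = F w / H w"
  have "polyfun 3 (\<lambda>v. F v + (- \<beta>) * H v)"
    by (intro polyfun_add polyfun_scale assms)
  then have pf: "polyfun (Suc 2) (\<lambda>v. F v + (- \<beta>) * H v)"
    by (simp add: numeral_3_eq_3 numeral_2_eq_2 del: polyfun.simps)
  have "card {a, b, c, w} > Suc 2" using w(2) zero(2) by auto
  moreover have "det3 a b v = 0 \<and> F v + (- \<beta>) * H v = 0" if "v \<in> {a, b, c, w}" for v
    using that zero w(1) \<open>H w \<noteq> 0\<close> by (auto simp: \<beta>_def)
  ultimately obtain G where G: "polyfun 2 G" "\<And>v. F v + (- \<beta>) * H v = det3 a b v * G v"
    using polyfun_factor[OF assms(3) pf, of "{a, b, c, w}"] by blast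
  show thesis
  proof (rule that)
    show "polyfun 2 G" by (rule G)
    show "F v = \<beta> * H v + det3 a b v * G v" for v using G(2)[of v] by simp
  qed
qed

lemma quadric_split_line:
  assumes "polyfun 2 Q" "det3 a b c = 0" "distinct [a, b, c]" "Q a = 0" "Q b = 0" "Q c = 0"
  obtains L where "polyfun 1 L" "\<And>v. Q v = det3 a b v * L v"
proof -
  have "polyfun (Suc 1) Q" using assms(1) by (simp add: numeral_2_eq_2 del: polyfun.simps)
  moreover have "card {a, b, c} > Suc 1" "a \<noteq> b" using assms(3) by auto
  moreover have "det3 a b v = 0 \<and> Q v = 0" if "v \<in> {a, b, c}" for v
    using that assms by auto
  ultimately show thesis using polyfun_factor[of a b 1 Q "{a, b, c}"] that by blast
qed

lemma linear_split_line:
  assumes "polyfun 1 L" "a \<noteq> b" "det3 a b u = 0" "det3 a b v = 0" "u \<noteq> v" "L u = 0" "L v = 0"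
  obtains \<gamma> where "\<And>x. L x = det3 a b x * \<gamma>"
proof -
  have "polyfun (Suc 0) L" using assms(1) by (simp del: polyfun.simps)
  moreover have "card {u, v} > Suc 0" using assms(5) by auto
  moreover have "det3 a b x = 0 \<and> L x = 0" if "x \<in> {u, v}" for x
    using that assms by auto
  ultimately obtain G where "polyfun 0 G" "\<And>x. L x = det3 a b x * G x"
    using polyfun_factor[OF assms(2), of 0 L "{u, v}"] by blast
  then show thesis using that by auto
qed

text \<open>The Cayley-Bacharach theorem for the nine points cut out by alternate sides of a hexagon whose
  opposite sides meet at \<open>r1\<close>, \<open>r2\<close>, \<open>r3\<close>.\<close>
lemma hexagon_cubic:
  assumes F: "polyfun 3 F" and gp: "gp3 P" and P: "set [h1, h2, h3, h4, h5, h6] \<subseteq> P"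
    and dist: "distinct [h1, h2, h3, h4, h5, h6]" and R: "r1 \<notin> P" "r2 \<notin> P" "r3 \<notin> P"
    and r1: "det3 h1 h2 r1 = 0" "det3 h4 h5 r1 = 0"
    and r3: "det3 h2 h3 r3 = 0" "det3 h5 h6 r3 = 0"
    and r2: "det3 h3 h4 r2 = 0" "det3 h6 h1 r2 = 0"
    and zero: "F h1 = 0" "F h2 = 0" "F h3 = 0" "F h4 = 0" "F r1 = 0" "F r2 = 0"
    and uv: "u \<in> {h5, h6, r3}" "v \<in> {h5, h6, r3}" "u \<noteq> v" "F u = 0" "F v = 0"
  shows "F h5 = 0 \<and> F h6 = 0 \<and> F r3 = 0"
proof -
  \<comment> \<open>\<open>H\<close> is the product of three alternate sides; it meets the other
    sides \<open>h1 h2\<close>, \<open>h3 h4\<close>, \<open>h5 h6\<close> in the six vertices and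
    \<open>r1\<close>, \<open>r2\<close>, \<open>r3\<close>. Splitting off these three sides one
    after another writes \<open>F\<close> as a combination of the two products of lines, and both
    products vanish at all nine points.\<close>
  define H where "H = (\<lambda>v. det3 h4 h5 v * (det3 h6 h1 v * det3 h2 h3 v))"
  have ne: "r1 \<noteq> h" "r2 \<noteq> h" "r3 \<noteq> h" if "h \<in> P" for h
    using R that by auto
  have mem: "h1 \<in> P" "h2 \<in> P" "h3 \<in> P" "h4 \<in> P" "h5 \<in> P" "h6 \<in> P" using P by auto
  have d: "h1 \<noteq> h2" "h1 \<noteq> h3" "h1 \<noteq> h4" "h1 \<noteq> h5" "h1 \<noteq> h6" "h2 \<noteq> h3" "h2 \<noteq> h4" "h2 \<noteq> h5"
    "h2 \<noteq> h6" "h3 \<noteq> h4" "h3 \<noteq> h5" "h3 \<noteq> h6" "h4 \<noteq> h5" "h4 \<noteq> h6" "h5 \<noteq> h6"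
    using dist by auto
  note D = gp3D[OF gp]
  have 1: "w \<in> {h1, h2, r1}" if "det3 h1 h2 w = 0" "H w = 0" for w
  proof -
    have "det3 h4 h5 w = 0 \<or> det3 h6 h1 w = 0 \<or> det3 h2 h3 w = 0"
      using that(2) by (auto simp: H_def)
    moreover have "w = r1" if "det3 h4 h5 w = 0"
      using lines_share_two_points[OF \<open>det3 h1 h2 w = 0\<close> r1(1) that r1(2)] d D mem by metis
    moreover have "w = h1" if "det3 h6 h1 w = 0"
      using lines_share_two_points[OF \<open>det3 h1 h2 w = 0\<close> det3_same(2) that det3_same(3)] d D mem
      by (metis det3_same)
    moreover have "w = h2" if "det3 h2 h3 w = 0"
      using lines_corner[OF \<open>det3 h1 h2 w = 0\<close> that] d D mem by metis
    ultimately show ?thesis by blast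
  qed
  obtain \<beta> Q where Q: "polyfun 2 Q" "\<And>v. F v = \<beta> * H v + det3 h1 h2 v * Q v"
  proof (rule cubic_split_line[OF F, of H h1 h2 r1])
    show "polyfun 3 H" unfolding H_def by (rule polyfun_lines3)
    show "H h1 = 0" "H h2 = 0" "H r1 = 0" using r1 by (simp_all add: H_def)
  qed (use 1 d ne mem zero r1 in auto)
  have r2': "det3 h1 h2 r2 \<noteq> 0"
    using lines_corner[of h6 h1 r2 h2] r2 d D[of h6 h1 h2] mem ne[of h1] by auto
  have Q0: "Q x = 0" if "F x = 0" "H x = 0" "det3 h1 h2 x \<noteq> 0" for x
    using Q(2)[of x] that by auto
  obtain L where L: "polyfun 1 L" "\<And>v. Q v = det3 h3 h4 v * L v"
  proof (rule quadric_split_line[OF Q(1), of h3 h4 r2])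
    show "Q h3 = 0" "Q h4 = 0" "Q r2 = 0"
      using zero r2 r2' d D mem by (auto intro!: Q0 simp: H_def)
  qed (use r2 ne d mem in auto)
  have nz: "det3 h1 h2 x \<noteq> 0 \<and> det3 h3 h4 x \<noteq> 0 \<and> H x = 0 \<and> det3 h5 h6 x = 0" if "x \<in> {h5, h6, r3}" for x
  proof -
    have "det3 h1 h2 r3 \<noteq> 0"
      using lines_corner[of h1 h2 r3 h3] r3 d D[of h1 h2 h3] mem ne[of h2] by auto
    moreover have "det3 h3 h4 r3 \<noteq> 0"
      using lines_corner[of h2 h3 r3 h4] r3 d D[of h2 h3 h4] mem ne[of h3] by auto
    ultimately show ?thesis using that d D mem r3 by (auto simp: H_def)
  qed
  have L0: "L x = 0" if "x \<in> {h5, h6, r3}" "F x = 0" for x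
    using Q0[OF that(2)] nz[OF that(1)] L(2)[of x] by simp
  obtain \<gamma> where "\<And>x. L x = det3 h5 h6 x * \<gamma>"
    using linear_split_line[OF L(1) d(15), of u v] L0 uv nz by blast
  then have "F x = 0" if "x \<in> {h5, h6, r3}" for x
    using Q(2)[of x] L(2)[of x] nz[OF that] by simp
  then show ?thesis by simp
qed

section \<open>Cubics given by bivariate polynomials\<close>

lemma polyfun_total_degree:
  assumes "total_degree_le f d" shows "polyfun d (eval2 f)"
proof -
  have mono: "polyfun e (\<lambda>v. v $ 1 ^ i * v $ 2 ^ j)" if "i + j \<le> e" for i j e
    using that
  proof (induction e arbitrary: i j)
    case 0
    then show ?case by auto
  next
    case (Suc e)
    show ?case
    proof (cases i)
      case (Suc i')
      have "polyfun (Suc e) (\<lambda>v. v $ 1 * (v $ 1 ^ i' * v $ 2 ^ j))"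
        by (intro polyfun_coord Suc.IH) (use Suc Suc.prems in simp)
      then show ?thesis by (simp add: Suc mult.assoc del: polyfun.simps)
    next
      case 0
      show ?thesis
      proof (cases j)
        case (Suc j')
        have "polyfun (Suc e) (\<lambda>v. v $ 2 * (v $ 1 ^ 0 * v $ 2 ^ j'))"
          by (intro polyfun_coord Suc.IH) (use Suc 0 Suc.prems in simp)
        then show ?thesis by (simp add: Suc 0 del: polyfun.simps)
      next
        case 0
        then show ?thesis using \<open>i = 0\<close> polyfun_const[of "Suc e" 1] by (simp del: polyfun.simps)
      qed
    qed
  qed
  have sum: "polyfun d (\<lambda>v. \<Sum>k\<in>A. g k v)" if "\<And>k. k \<in> A \<Longrightarrow> polyfun d (g k)" "finite A"
    for A :: "nat set" and g
    using that(2,1) by (induction A rule: finite_induct) (auto intro: polyfun_const polyfun_add simp del: polyfun.simps)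
  have "eval2 f v = (\<Sum>j\<le>degree f. \<Sum>i\<le>degree (coeff f j). coeff (coeff f j) i * (v $ 1 ^ i * v $ 2 ^ j))" for v
  proof -
    have "eval2 f v = (\<Sum>j\<le>degree f. poly (coeff f j) (v $ 1) * v $ 2 ^ j)"
      unfolding eval2_def by (subst poly_altdef[of f]) (simp add: poly_sum)
    then show ?thesis by (simp add: poly_altdef sum_distrib_right mult.assoc)
  qed
  then have ev: "eval2 f = (\<lambda>v. \<Sum>j\<le>degree f. \<Sum>i\<le>degree (coeff f j). coeff (coeff f j) i * (v $ 1 ^ i * v $ 2 ^ j))"
    by blast
  show ?thesis
    unfolding ev
  proof (intro sum)
    fix i j
    show "polyfun d (\<lambda>v. coeff (coeff f j) i * (v $ 1 ^ i * v $ 2 ^ j))"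
    proof (cases "coeff (coeff f j) i = 0")
      case True
      then show ?thesis using polyfun_const[of d 0] by (simp del: polyfun.simps)
    next
      case False
      then show ?thesis using assms by (intro polyfun_scale mono) (auto simp: total_degree_le_def)
    qed
  qed auto
qed

text \<open>The ten monomials of degree at most three send the points to at most nine vectors of a
  ten-dimensional space; a nonzero vector orthogonal to all of them consists of the coefficients of
  the cubic.\<close>

lemma cubic_through_nine_points:
  assumes "finite S" "card S \<le> 9"
  obtains f where "f \<noteq> 0" "total_degree_le f 3" "\<And>v. v \<in> S \<Longrightarrow> eval2 f v = 0"
proof -
  define m :: "real ^ 2 \<Rightarrow> real \<times> real \<times> real \<times> real \<times> real \<times> real \<times> real \<times> real \<times> real \<times> real"
    where "m v = (1, v $ 1, v $ 1 ^ 2, v $ 1 ^ 3, v $ 2, v $ 1 * v $ 2, v $ 1 ^ 2 * v $ 2,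
      v $ 2 ^ 2, v $ 1 * v $ 2 ^ 2, v $ 2 ^ 3)" for v
  have "dim (m ` S) \<le> card (m ` S)" using assms(1) by (intro dim_le_card') auto
  also have "\<dots> \<le> 9" using assms card_image_le[OF assms(1), of m] by linarith
  finally have "dim (m ` S) < DIM(real \<times> real \<times> real \<times> real \<times> real \<times> real \<times> real \<times> real \<times> real \<times> real)"
    by simp
  then obtain c where c: "c \<noteq> 0" "\<And>y. y \<in> span (m ` S) \<Longrightarrow> orthogonal c y"
    using orthogonal_to_subspace_exists[of "m ` S"] by blast
  obtain c0 c1 c2 c3 c4 c5 c6 c7 c8 c9 where ceq: "c = (c0, c1, c2, c3, c4, c5, c6, c7, c8, c9)"
    by (metis prod.collapse)
  define f where "f = [: [:c0, c1, c2, c3:], [:c4, c5, c6:], [:c7, c8:], [:c9:] :]"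
  show thesis
  proof (rule that[of f])
    show "f \<noteq> 0" using c(1) by (auto simp: f_def ceq zero_prod_def)
    show "total_degree_le f 3"
      unfolding total_degree_le_def f_def
      by (auto simp: coeff_pCons split: nat.splits)
    show "eval2 f v = 0" if "v \<in> S" for v
    proof -
      have "orthogonal c (m v)" using c(2) that by (simp add: span_base)
      then show ?thesis
        by (simp add: orthogonal_def ceq m_def eval2_def f_def algebra_simps power2_eq_square power3_eq_cube)
    qed
  qed
qed

text \<open>For a pentagon the hexagon relation degenerates: two consecutive vertices coincide in \<open>p0\<close>,
  and \<open>p0 r0\<close> plays the role of the tangent. The first decomposition of \<open>F\<close> shows that this
  line is tangent to the cubic at \<open>p0\<close>, the second one uses it.\<close>
lemma pentagon_cubic:
  assumes F: "polyfun 3 F" and gp: "gp3 P" and P: "set [p0, p1, p2, p3, p4] \<subseteq> P"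
    and dist: "distinct [p0, p1, p2, p3, p4]"
    and R: "r0 \<notin> P" "r1 \<notin> P" "r2 \<notin> P" "r3 \<notin> P" "r4 \<notin> P"
    and r0: "det3 p1 p4 r0 = 0" "det3 p2 p3 r0 = 0"
    and r1: "det3 p0 p1 r1 = 0" "det3 p2 p4 r1 = 0"
    and r2: "det3 p0 p2 r2 = 0" "det3 p3 p4 r2 = 0"
    and r3: "det3 p0 p3 r3 = 0" "det3 p1 p2 r3 = 0"
    and r4: "det3 p0 p4 r4 = 0" "det3 p1 p3 r4 = 0"
    and zero: "F p0 = 0" "F p1 = 0" "F p2 = 0" "F p3 = 0" "F p4 = 0"
      "F r0 = 0" "F r1 = 0" "F r2 = 0" "F r3 = 0"
  shows "F r4 = 0"
proof -
  have ne: "r0 \<noteq> p" "r1 \<noteq> p" "r2 \<noteq> p" "r3 \<noteq> p" "r4 \<noteq> p" if "p \<in> P" for p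
    using R that by auto
  have mem: "p0 \<in> P" "p1 \<in> P" "p2 \<in> P" "p3 \<in> P" "p4 \<in> P" using P by auto
  have d: "p0 \<noteq> p1" "p0 \<noteq> p2" "p0 \<noteq> p3" "p0 \<noteq> p4" "p1 \<noteq> p2" "p1 \<noteq> p3" "p1 \<noteq> p4"
    "p2 \<noteq> p3" "p2 \<noteq> p4" "p3 \<noteq> p4"
    using dist by auto
  note D = gp3D[OF gp]
  note perm = det3_eq_0_perm
  \<comment> \<open>The sides of the degenerate hexagon \<open>p4 p1 p2 p0 p0 p3\<close>, with
    \<open>p0 r0\<close> for the side from \<open>p0\<close> to itself: \<open>H\<close> collects
    three alternate ones, and \<open>p4 p1\<close>, \<open>p0 p3\<close>, \<open>p0 p2\<close> are
    split off below.\<close>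
  define H where "H = (\<lambda>v. det3 p3 p4 v * (det3 p1 p2 v * det3 p0 r0 v))"
  have r0_41: "w = r0" if "det3 p4 p1 w = 0" "det3 p0 r0 w = 0" for w
    using lines_corner[of p0 r0 w p1] lines_corner[of p4 r0 w p0] that perm[OF r0(1)] d D[of p4 p1 p0] mem ne(1)
      lines_share_two_points[of p4 p1 w r0 p0 r0] by (metis det3_same)
  have 1: "w \<in> {p4, p1, r0}" if "det3 p4 p1 w = 0" "H w = 0" for w
  proof -
    have "det3 p3 p4 w = 0 \<or> det3 p1 p2 w = 0 \<or> det3 p0 r0 w = 0"
      using that(2) by (auto simp: H_def)
    moreover have "w = p4" if "det3 p3 p4 w = 0"
      using lines_corner[OF that \<open>det3 p4 p1 w = 0\<close>] D[of p3 p4 p1] mem d by metis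
    moreover have "w = p1" if "det3 p1 p2 w = 0"
      using lines_corner[OF \<open>det3 p4 p1 w = 0\<close> that] D[of p4 p1 p2] mem d by metis
    ultimately show ?thesis using r0_41 that(1) by blast
  qed
  obtain \<beta> Q where Q: "polyfun 2 Q" "\<And>v. F v = \<beta> * H v + det3 p4 p1 v * Q v"
  proof (rule cubic_split_line[OF F, of H p4 p1 r0])
    show "polyfun 3 H" unfolding H_def by (rule polyfun_lines3)
    show "H p4 = 0" "H p1 = 0" "H r0 = 0" by (simp_all add: H_def)
  qed (use 1 d ne(1)[OF mem(5)] ne(1)[OF mem(2)] zero perm[OF r0(1)] in auto)
  have Q0: "Q x = 0" if "F x = 0" "H x = 0" "det3 p4 p1 x \<noteq> 0" for x
    using Q(2)[of x] that by auto
  have nr3: "det3 p4 p1 r3 \<noteq> 0"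
    using lines_corner[of p4 p1 r3 p2] r3 D[of p4 p1 p2] d mem ne(4)[OF mem(2)] by auto
  have nr2: "det3 p4 p1 r2 \<noteq> 0"
    using lines_corner[of p3 p4 r2 p1] r2 D[of p3 p4 p1] d mem ne(3)[OF mem(5)] by auto
  obtain L where L: "polyfun 1 L" "\<And>v. Q v = det3 p0 p3 v * L v"
  proof (rule quadric_split_line[OF Q(1), of p0 p3 r3])
    show "Q p0 = 0" "Q p3 = 0" "Q r3 = 0"
      using zero r3 nr3 d D[of p4 p1 p0] D[of p4 p1 p3] mem by (auto intro!: Q0 simp: H_def)
  qed (use r3 ne(4) d mem in auto)
  have nr2': "det3 p0 p3 r2 \<noteq> 0"
    using lines_corner[of p0 p3 r2 p4] r2 D[of p0 p3 p4] d mem ne(3)[OF mem(4)] by auto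
  have L0: "L p2 = 0" "L r2 = 0"
    using Q0[of p2] Q0[of r2] L(2)[of p2] L(2)[of r2] zero r2 nr2 nr2' D[of p4 p1 p2] D[of p0 p3 p2] d mem
    by (auto simp: H_def)
  obtain \<gamma> where \<gamma>: "\<And>x. L x = det3 p0 p2 x * \<gamma>"
    using linear_split_line[OF L(1) d(2) _ r2(1) _ L0] ne(3)[OF mem(3)] by force
  \<comment> \<open>On the line \<open>p0 r0\<close> the product \<open>H\<close> vanishes, and the
    other product contains two lines through \<open>p0\<close>. So along this line \<open>F\<close>
    vanishes at \<open>p0\<close> at least doubly.\<close>
  have F1: "F v = \<beta> * H v + \<gamma> * det3 p4 p1 v * det3 p0 p3 v * det3 p0 p2 v" for v
    by (simp add: Q L \<gamma>)
  \<comment> \<open>Now the degenerate hexagon is \<open>p2 p3 p1 p0 p0 p4\<close>, whose opposite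
    sides meet at \<open>r0\<close>, \<open>r4\<close> and \<open>r1\<close>. For the last division
    only the zero \<open>p4\<close> of \<open>L'\<close> is at hand; the zero \<open>p0\<close> has
    to come from the tangency.\<close>
  define K where "K = (\<lambda>v. det3 p2 p4 v * (det3 p1 p3 v * det3 p0 r0 v))"
  have 2: "w \<in> {p2, p3, r0}" if "det3 p2 p3 w = 0" "K w = 0" for w
  proof -
    have "det3 p2 p4 w = 0 \<or> det3 p1 p3 w = 0 \<or> det3 p0 r0 w = 0"
      using that(2) by (auto simp: K_def)
    moreover have "w = p2" if "det3 p2 p4 w = 0"
      using lines_corner[of p3 p2 w p4] perm[OF \<open>det3 p2 p3 w = 0\<close>] that D[of p3 p2 p4] mem d by metis
    moreover have "w = p3" if "det3 p1 p3 w = 0"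
      using lines_corner[of p2 p3 w p1] perm[OF that] \<open>det3 p2 p3 w = 0\<close> D[of p2 p3 p1] mem d by metis
    moreover have "w = r0" if "det3 p0 r0 w = 0"
      using that \<open>det3 p2 p3 w = 0\<close> r0(2) d D[of p2 p3 p0] mem ne(1)
        lines_share_two_points[of p2 p3 w r0 p0 r0] by (metis det3_same)
    ultimately show ?thesis by blast
  qed
  obtain \<beta>' Q' where Q': "polyfun 2 Q'" "\<And>v. F v = \<beta>' * K v + det3 p2 p3 v * Q' v"
  proof (rule cubic_split_line[OF F, of K p2 p3 r0])
    show "polyfun 3 K" unfolding K_def by (rule polyfun_lines3)
    show "K p2 = 0" "K p3 = 0" "K r0 = 0" by (simp_all add: K_def)
  qed (use 2 d ne(1)[OF mem(4)] ne(1)[OF mem(3)] zero r0 in auto)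
  have Q0': "Q' x = 0" if "F x = 0" "K x = 0" "det3 p2 p3 x \<noteq> 0" for x
    using Q'(2)[of x] that by auto
  have nr1: "det3 p2 p3 r1 \<noteq> 0"
    using lines_corner[of p3 p2 r1 p4] r1 perm[of p2 p3 r1] D[of p3 p2 p4] d mem ne(2)[OF mem(3)] by auto
  obtain L' where L': "polyfun 1 L'" "\<And>v. Q' v = det3 p0 p1 v * L' v"
  proof (rule quadric_split_line[OF Q'(1), of p0 p1 r1])
    show "Q' p0 = 0" "Q' p1 = 0" "Q' r1 = 0"
      using zero r1 nr1 d D[of p2 p3 p0] D[of p2 p3 p1] mem by (auto intro!: Q0' simp: K_def)
  qed (use r1 ne(2) d mem in auto)
  have L'4: "L' p4 = 0"
    using Q0'[of p4] L'(2)[of p4] zero D[of p2 p3 p4] D[of p0 p1 p4] d mem by (auto simp: K_def)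
  obtain c g h where cgh: "L' = (\<lambda>v. c + v $ 1 * g + v $ 2 * h)"
    using L'(1) by (auto simp: One_nat_def)
  define q where "q t = p0 + t *\<^sub>R (r0 - p0)" for t
  define m0 m1 n0 n1 l0 l1 A B C where
    "m0 = det3 p4 p1 p0" and "m1 = det3 p4 p1 r0 - det3 p4 p1 p0" and
    "n0 = det3 p2 p3 p0" and "n1 = det3 p2 p3 r0 - det3 p2 p3 p0" and
    "l0 = L' p0" and "l1 = L' r0 - L' p0" and
    "A = det3 p0 p3 r0" and "B = det3 p0 p2 r0" and "C = det3 p0 p1 r0"
  have on_q: "det3 p4 p1 (q t) = m0 + m1 * t" "det3 p2 p3 (q t) = n0 + n1 * t" "L' (q t) = l0 + l1 * t"
    "det3 p0 p3 (q t) = t * A" "det3 p0 p2 (q t) = t * B" "det3 p0 p1 (q t) = t * C" "det3 p0 r0 (q t) = 0" for t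
    by (simp_all add: q_def m0_def m1_def n0_def n1_def l0_def l1_def A_def B_def C_def cgh det3_alt algebra_simps)
  have "t * (\<gamma> * (m0 + m1 * t) * t * A * B) = t * ((n0 + n1 * t) * C * (l0 + l1 * t))" for t
    using F1[of "q t"] Q'(2)[of "q t"] by (simp add: H_def K_def on_q L' algebra_simps)
  then have eq: "\<gamma> * (m0 + m1 * t) * t * A * B = (n0 + n1 * t) * C * (l0 + l1 * t)" if "t \<noteq> 0" for t
    using that mult_left_cancel by blast
  \<comment> \<open>Both sides of \<open>eq\<close> have degree at most two in \<open>t\<close> and
    agree at three values, so their constant terms agree, and the one on the left is zero.\<close>
  have "n0 * C * l0 = 0"
    using eq[of 1, OF one_neq_zero] eq[of "-1", simplified] eq[of 2, simplified] by algebra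
  moreover have "n0 \<noteq> 0" using D[of p2 p3 p0] d mem by (auto simp: n0_def)
  moreover have "C \<noteq> 0"
    using lines_corner[of p0 p1 r0 p4] r0 D[of p0 p1 p4] d mem ne(1)[OF mem(2)] by (auto simp: C_def)
  ultimately have "L' p0 = 0" by (simp add: l0_def)
  then obtain \<gamma>' where "\<And>x. L' x = det3 p0 p4 x * \<gamma>'"
    using linear_split_line[OF L'(1) d(4), of p0 p4] d L'4 by auto
  then show ?thesis using Q'(2)[of r4] L'(2)[of r4] r4 by (simp add: K_def)
qed

subsection \<open>Bipartitions by lines through a point\<close>

definition left_set :: "(real ^ 2) set \<Rightarrow> real ^ 2 \<Rightarrow> real ^ 2 \<Rightarrow> (real ^ 2) set" where
  "left_set P r u = {k \<in> P. det2 u (k - r) > 0}"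

text \<open>In the dual plane \<open>P\<close> becomes an arrangement of lines, and \<open>cells P r\<close> are the faces that the line
  dual to \<open>r\<close> crosses. Each bipartition occurs twice, once for each side of the line.\<close>
definition cells :: "(real ^ 2) set \<Rightarrow> real ^ 2 \<Rightarrow> (real ^ 2) set set" where
  "cells P r = {left_set P r u | u. \<forall>k\<in>P. det2 u (k - r) \<noteq> 0}"

definition line_class :: "(real ^ 2) set \<Rightarrow> real ^ 2 \<Rightarrow> real ^ 2 \<Rightarrow> (real ^ 2) set" where
  "line_class P r p = {k \<in> P. det3 r p k = 0}"

definition lines :: "(real ^ 2) set \<Rightarrow> real ^ 2 \<Rightarrow> (real ^ 2) set set" where
  "lines P r = line_class P r ` P"

definition secants :: "(real ^ 2) set \<Rightarrow> real ^ 2 \<Rightarrow> (real ^ 2) set set" where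
  "secants P r = {c \<in> lines P r. card c = 2}"

section \<open>Comparing directions by determinants and cotangents\<close>

lemma det2_uminus [simp]: "det2 (- u) w = - det2 u w" "det2 u (- w) = - det2 u w"
  by (simp_all add: det2_def)

lemma det2_scaleR [simp]: "det2 (t *\<^sub>R u) w = t * det2 u w" "det2 u (t *\<^sub>R w) = t * det2 u w"
  by (simp_all add: det2_def algebra_simps)

lemma det2_parallel:
  assumes "det2 d w = 0" "d \<noteq> 0"
  shows "w = ((w \<bullet> d) / (d \<bullet> d)) *\<^sub>R d"
  using line_coordinate[of 0 d w] assms by (simp add: det3_def)

lemma det2_parallel_inner:
  assumes "det2 d w = 0" "d \<noteq> 0" "w \<noteq> 0"
  shows "d \<bullet> w \<noteq> 0"
  using det2_parallel[OF assms(1,2)] assms(3) by (auto simp: inner_commute)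

text \<open>The cotangent of the angle from \<open>u\<close> to \<open>w\<close>, which orders a half-plane bounded by \<open>u\<close>; junk when
  \<open>u\<close> and \<open>w\<close> are parallel.\<close>
definition cotan :: "real ^ 2 \<Rightarrow> real ^ 2 \<Rightarrow> real" where
  "cotan u w = (w \<bullet> u) / det2 u w"

lemma det2_cotan:
  assumes "det2 u w \<noteq> 0" "det2 u w' \<noteq> 0"
  shows "det2 w w' * (u \<bullet> u) = det2 u w * det2 u w' * (cotan u w - cotan u w')"
proof -
  have "det2 u w * det2 u w' * (cotan u w - cotan u w') = (w \<bullet> u) * det2 u w' - (w' \<bullet> u) * det2 u w"
    using assms by (simp add: cotan_def field_simps)
  also have "\<dots> = det2 w w' * (u \<bullet> u)"
    by (simp add: det2_def inner2 algebra_simps)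
  finally show ?thesis by simp
qed

text \<open>To the left of \<open>u\<close> the cotangent decreases as a direction turns
  counterclockwise. The sign of \<open>det2\<close> thus becomes a comparison of real keys, for
  which minima and maxima exist.\<close>

lemma det2_pos_cotan:
  assumes "det2 u w > 0" "det2 u w' > 0"
  shows "det2 w w' > 0 \<longleftrightarrow> cotan u w' < cotan u w" "det2 w w' = 0 \<longleftrightarrow> cotan u w = cotan u w'"
    "det2 w w' < 0 \<longleftrightarrow> cotan u w < cotan u w'"
proof -
  have "u \<noteq> 0" using assms by (auto simp: det2_def)
  then have u: "u \<bullet> u > 0" by simp
  have pos: "det2 u w * det2 u w' > 0" using assms by simp
  have eq: "det2 w w' * (u \<bullet> u) = det2 u w * det2 u w' * (cotan u w - cotan u w')"
    using det2_cotan assms by simp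
  have "det2 w w' > 0 \<longleftrightarrow> det2 w w' * (u \<bullet> u) > 0" "det2 w w' = 0 \<longleftrightarrow> det2 w w' * (u \<bullet> u) = 0"
    "det2 w w' < 0 \<longleftrightarrow> det2 w w' * (u \<bullet> u) < 0"
    using u by (auto simp: zero_less_mult_iff mult_less_0_iff simp del: inner_gt_zero_iff inner_eq_zero_iff)
  then show "det2 w w' > 0 \<longleftrightarrow> cotan u w' < cotan u w" "det2 w w' = 0 \<longleftrightarrow> cotan u w = cotan u w'"
    "det2 w w' < 0 \<longleftrightarrow> cotan u w < cotan u w'"
    using pos unfolding eq by (auto simp: zero_less_mult_iff mult_less_0_iff)
qed

text \<open>The bipartition by the line through \<open>r\<close> in direction \<open>d\<close> after turning it slightly
  counterclockwise.\<close>
definition cut :: "(real ^ 2) set \<Rightarrow> real ^ 2 \<Rightarrow> real ^ 2 \<Rightarrow> (real ^ 2) set" where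
  "cut P r d = {k \<in> P. det2 d (k - r) > 0 \<or> (det2 d (k - r) = 0 \<and> d \<bullet> (k - r) < 0)}"

lemma cut_scale: "t > 0 \<Longrightarrow> cut P r (t *\<^sub>R d) = cut P r d"
  by (auto simp: cut_def zero_less_mult_iff mult_less_0_iff)

lemma cut_parallel:
  assumes "det2 d d' = 0" "d \<noteq> 0" "d' \<noteq> 0"
  shows "cut P r d' \<in> {cut P r d, cut P r (- d)}"
proof -
  define t where "t = (d' \<bullet> d) / (d \<bullet> d)"
  have d': "d' = t *\<^sub>R d" using det2_parallel[OF assms(1,2)] by (simp add: t_def)
  then have "t \<noteq> 0" using assms(3) by auto
  then consider "t > 0" | "- t > 0" by linarith
  then show ?thesis
  proof cases
    case 1
    then show ?thesis using cut_scale d' by blast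
  next
    case 2
    have "d' = (- t) *\<^sub>R (- d)" using d' by simp
    then show ?thesis using cut_scale[OF 2, of P r "- d"] by simp
  qed
qed

text \<open>Turn the line about \<open>r\<close> clockwise from \<open>u\<close> until it first
  meets \<open>P\<close>, at \<open>p\<close>; up to that moment the bipartition does not change.
  The point \<open>p\<close> may lie on either ray from \<open>r\<close>, hence the two
  alternatives.\<close>

lemma left_set_is_cut:
  assumes "finite P" "P \<noteq> {}" "\<forall>k\<in>P. det2 u (k - r) \<noteq> 0"
  shows "\<exists>p\<in>P. left_set P r u = cut P r (p - r) \<or> left_set P r u = cut P r (r - p)"
proof -
  \<comment> \<open>\<open>w k\<close> is the direction of the line through \<open>r\<close> and
    \<open>k\<close> that points to the right of \<open>u\<close>. The least cotangent with respect
    to \<open>- u\<close> belongs to the first such direction met clockwise from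
    \<open>u\<close>.\<close>
  define w where "w k = (if det2 u (k - r) < 0 then k - r else r - k)" for k
  have w: "det2 u (w k) < 0" if "k \<in> P" for k
  proof -
    have "det2 u (k - r) \<noteq> 0" using assms(3) that by blast
    then show ?thesis using det2_uminus(2)[of u "k - r"] by (auto simp: w_def)
  qed
  then have wn: "det2 (- u) (w k) > 0" if "k \<in> P" for k using that by simp
  define \<phi> where "\<phi> k = cotan (- u) (w k)" for k
  define p where "p = arg_min_on \<phi> P"
  have p: "p \<in> P" "\<And>k. k \<in> P \<Longrightarrow> \<phi> p \<le> \<phi> k"
    using arg_min_if_finite(1)[OF assms(1,2), of \<phi>] arg_min_least[OF assms(1,2), of _ \<phi>] by (auto simp: p_def)
  have le: "det2 (w p) (w k) \<le> 0" and eq: "det2 (w p) (w k) = 0 \<Longrightarrow> w p \<bullet> w k > 0" if k: "k \<in> P" for k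
  proof -
    show "det2 (w p) (w k) \<le> 0"
      using det2_pos_cotan(1)[OF wn[OF p(1)] wn[OF k]] p(2)[OF k] unfolding \<phi>_def by linarith
    assume 0: "det2 (w p) (w k) = 0"
    have "w p \<noteq> 0" using w[OF p(1)] by (auto simp: det2_def)
    then have "w k = ((w k \<bullet> w p) / (w p \<bullet> w p)) *\<^sub>R w p" using det2_parallel 0 by blast
    then have "det2 u (w k) = ((w k \<bullet> w p) / (w p \<bullet> w p)) * det2 u (w p)"
      by (metis det2_scaleR(2))
    then have "(w k \<bullet> w p) / (w p \<bullet> w p) > 0"
      using w[OF p(1)] w[OF k] by (metis mult_less_0_iff not_less_iff_gr_or_eq)
    then have "(w k \<bullet> w p) / (w p \<bullet> w p) * (w p \<bullet> w p) > 0"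
      using \<open>w p \<noteq> 0\<close> by (intro mult_pos_pos) simp_all
    then show "w p \<bullet> w k > 0" using \<open>w p \<noteq> 0\<close> by (simp add: inner_commute)
  qed
  have "left_set P r u = cut P r (w p)"
  proof -
    have "det2 u (k - r) > 0 \<longleftrightarrow> det2 (w p) (k - r) > 0 \<or> (det2 (w p) (k - r) = 0 \<and> w p \<bullet> (k - r) < 0)"
      if k: "k \<in> P" for k
    proof (cases "det2 u (k - r) < 0")
      case True
      then have "w k = k - r" by (simp add: w_def)
      then show ?thesis using le[OF k] eq[OF k] True by auto
    next
      case False
      then have *: "det2 u (k - r) > 0" using assms(3) k by force
      have "w k = - (k - r)" using False by (simp add: w_def)
      then show ?thesis using le[OF k] eq[OF k] * by (auto simp: inner_minus_right simp del: minus_diff_eq)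
    qed
    then show ?thesis unfolding left_set_def cut_def by blast
  qed
  then show ?thesis using p(1) by (auto simp: w_def)
qed

lemma finite_lines: "finite P \<Longrightarrow> finite (lines P r)"
  by (simp add: lines_def)

text \<open>By \<open>left_set_is_cut\<close> every bipartition is a cut just after a line through
  \<open>r\<close> and a point of \<open>P\<close>, and up to scaling such a line has only two
  directions.\<close>

lemma card_cells_le:
  assumes "finite P" "P \<noteq> {}" "r \<notin> P"
  shows "card (cells P r) \<le> 2 * card (lines P r)"
proof -
  define rep where "rep c = (SOME p. p \<in> P \<and> line_class P r p = c)" for c
  have rep: "rep c \<in> P" "line_class P r (rep c) = c" if "c \<in> lines P r" for c
    using that someI_ex[of "\<lambda>p. p \<in> P \<and> line_class P r p = c"] by (auto simp: lines_def rep_def)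
  have "cells P r \<subseteq> (\<lambda>c. cut P r (rep c - r)) ` lines P r \<union> (\<lambda>c. cut P r (- (rep c - r))) ` lines P r"
  proof
    fix A assume "A \<in> cells P r"
    then obtain u where u: "\<forall>k\<in>P. det2 u (k - r) \<noteq> 0" "A = left_set P r u"
      by (auto simp: cells_def)
    then obtain p where p: "p \<in> P" "A = cut P r (p - r) \<or> A = cut P r (- (p - r))"
      using left_set_is_cut[OF assms(1,2) u(1)] by auto
    define c where "c = line_class P r p"
    have c: "c \<in> lines P r" using p by (simp add: c_def lines_def)
    have "p \<in> c" using p by (simp add: c_def line_class_def)
    then have 0: "det2 (rep c - r) (p - r) = 0"
      using rep(2)[OF c] by (auto simp: line_class_def det3_def)
    have ne: "rep c - r \<noteq> 0" "p - r \<noteq> 0" using rep(1)[OF c] p(1) assms(3) by auto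
    have "cut P r (p - r) \<in> {cut P r (rep c - r), cut P r (- (rep c - r))}"
      by (rule cut_parallel[OF 0 ne])
    moreover have "cut P r (- (p - r)) \<in> {cut P r (rep c - r), cut P r (- (rep c - r))}"
      by (rule cut_parallel) (use 0 ne in \<open>simp_all del: minus_diff_eq\<close>)
    ultimately show "A \<in> (\<lambda>c. cut P r (rep c - r)) ` lines P r \<union> (\<lambda>c. cut P r (- (rep c - r))) ` lines P r"
      using p(2) c by blast
  qed
  then have "card (cells P r) \<le> card ((\<lambda>c. cut P r (rep c - r)) ` lines P r \<union> (\<lambda>c. cut P r (- (rep c - r))) ` lines P r)"
    by (intro card_mono) (auto simp: finite_lines assms(1))
  also have "\<dots> \<le> card (lines P r) + card (lines P r)"
    by (rule order_trans[OF card_Un_le]) (intro add_mono card_image_le finite_lines assms(1))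
  finally show ?thesis by simp
qed

lemma cells_complement:
  assumes "A \<in> cells P r" shows "P - A \<in> cells P r"
proof -
  obtain u where u: "\<forall>k\<in>P. det2 u (k - r) \<noteq> 0" "A = left_set P r u"
    using assms by (auto simp: cells_def)
  then have "P - A = left_set P r (- u)" by (force simp: left_set_def)
  then show ?thesis using u(1) unfolding cells_def by auto
qed

lemma cells_subset: "A \<in> cells P r \<Longrightarrow> A \<subseteq> P"
  by (auto simp: cells_def left_set_def)

lemma finite_cells: "finite P \<Longrightarrow> finite (cells P r)"
  by (rule finite_subset[of _ "Pow P"]) (auto dest: cells_subset)

text \<open>Rotating the line through \<open>r\<close> in direction \<open>u\<close> slightly, counterclockwise for \<open>s < 0\<close>.\<close>
lemma perturbed_cell:
  assumes "finite P" "r \<notin> P" "u \<noteq> 0" "s \<noteq> 0"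
  shows "{k \<in> P. det2 u (k - r) > 0 \<or> (det2 u (k - r) = 0 \<and> s * (u \<bullet> (k - r)) > 0)} \<in> cells P r"
proof -
  define b where "b k = s * (u \<bullet> (k - r))" for k
  define good where "good k \<epsilon> \<longleftrightarrow> det2 u (k - r) + \<epsilon> * b k \<noteq> 0 \<and>
    (det2 u (k - r) + \<epsilon> * b k > 0 \<longleftrightarrow> det2 u (k - r) > 0 \<or> (det2 u (k - r) = 0 \<and> b k > 0))" for k \<epsilon>
  have "eventually (good k) (at_right 0)" if k: "k \<in> P" for k
  proof -
    have lim: "((\<lambda>\<epsilon>. det2 u (k - r) + \<epsilon> * b k) \<longlongrightarrow> det2 u (k - r) + 0 * b k) (at_right 0)"
      by (intro tendsto_intros)
    consider "det2 u (k - r) > 0" | "det2 u (k - r) < 0" | "det2 u (k - r) = 0" by linarith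
    then show ?thesis
    proof cases
      case 1
      then have "eventually (\<lambda>\<epsilon>. det2 u (k - r) + \<epsilon> * b k > 0) (at_right 0)"
        using order_tendstoD(1)[OF lim, of 0] by simp
      then show ?thesis by eventually_elim (use 1 in \<open>auto simp: good_def\<close>)
    next
      case 2
      then have "eventually (\<lambda>\<epsilon>. det2 u (k - r) + \<epsilon> * b k < 0) (at_right 0)"
        using order_tendstoD(2)[OF lim, of 0] by simp
      then show ?thesis by eventually_elim (use 2 in \<open>auto simp: good_def\<close>)
    next
      case 3
      have "k - r \<noteq> 0" using k assms(2) by auto
      then have "b k \<noteq> 0" using det2_parallel_inner[OF 3 assms(3)] assms(4) by (simp add: b_def)
      moreover have "eventually (\<lambda>\<epsilon> :: real. \<epsilon> > 0) (at_right 0)" by (simp add: eventually_at_right_less)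
      ultimately show ?thesis
        by (elim eventually_mono) (use 3 in \<open>auto simp: good_def zero_less_mult_iff\<close>)
    qed
  qed
  then have "eventually (\<lambda>\<epsilon>. \<forall>k\<in>P. good k \<epsilon>) (at_right 0)"
    using assms(1) by (simp add: eventually_ball_finite)
  then obtain \<epsilon> where \<epsilon>: "\<forall>k\<in>P. good k \<epsilon>"
    using eventually_happens' trivial_limit_at_right_real by blast
  \<comment> \<open>The added vector is \<open>u\<close> turned clockwise by a right angle, up to
    the factor; its \<open>det2\<close> with any vector is the inner product of that vector with
    \<open>u\<close>.\<close>
  define u' where "u' = u + (s * \<epsilon>) *\<^sub>R vector [u $ 2, - u $ 1]"
  have u': "det2 u' (k - r) = det2 u (k - r) + \<epsilon> * b k" for k
    by (simp add: u'_def b_def det2_def inner2 vector_2 algebra_simps)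
  have "{k \<in> P. det2 u (k - r) > 0 \<or> (det2 u (k - r) = 0 \<and> s * (u \<bullet> (k - r)) > 0)} = left_set P r u'"
    using \<epsilon> by (auto simp: left_set_def u' good_def b_def)
  moreover have "\<forall>k\<in>P. det2 u' (k - r) \<noteq> 0" using \<epsilon> by (auto simp: u' good_def)
  ultimately show ?thesis unfolding cells_def by blast
qed

lemma left_setI_cells:
  "\<forall>k\<in>P. det2 u (k - r) \<noteq> 0 \<Longrightarrow> {k \<in> P. det2 u (k - r) > 0} \<in> cells P r"
  unfolding cells_def left_set_def by blast

lemma line_class_self: "p \<in> P \<Longrightarrow> p \<in> line_class P r p"
  by (simp add: line_class_def)

lemma line_class_eq:
  assumes "q \<in> line_class P r p" "p \<noteq> r" "q \<noteq> r"
  shows "line_class P r q = line_class P r p"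
proof -
  have q: "det3 r p q = 0" "det3 r q p = 0"
    using assms(1) det3_eq_0_perm(1) by (auto simp: line_class_def)
  have "det3 r q k = 0 \<longleftrightarrow> det3 r p k = 0" for k
    using det3_line_unique[OF q(1) _ assms(2)[symmetric]] det3_line_unique[OF q(2) _ assms(3)[symmetric]] by iprover
  then show ?thesis by (simp add: line_class_def)
qed

lemma lines_disjoint:
  assumes "r \<notin> P" "c \<in> lines P r" "c' \<in> lines P r" "x \<in> c" "x \<in> c'"
  shows "c = c'"
proof -
  obtain p p' where p: "p \<in> P" "c = line_class P r p" "p' \<in> P" "c' = line_class P r p'"
    using assms by (auto simp: lines_def)
  moreover have "x \<in> P" using assms(4) p by (simp add: line_class_def)
  moreover have "p \<noteq> r" "p' \<noteq> r" "x \<noteq> r" using assms(1) calculation by auto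
  ultimately show ?thesis using line_class_eq[of x P r p] line_class_eq[of x P r p'] assms(4,5) by simp
qed

lemma line_class_pair:
  assumes "gp3 P" "r \<notin> P" "i \<in> P" "j \<in> P" "i \<noteq> j" "det3 i j r = 0"
  shows "line_class P r i = {i, j}"
proof
  show "{i, j} \<subseteq> line_class P r i" using assms det3_eq_0_perm[OF assms(6)] by (auto simp: line_class_def)
  show "line_class P r i \<subseteq> {i, j}"
  proof
    fix k assume "k \<in> line_class P r i"
    then have k: "k \<in> P" "det3 r i k = 0" by (auto simp: line_class_def)
    have "det3 i j k = 0"
      using det3_line_unique[OF det3_eq_0_perm(1)[OF assms(6)] det3_eq_0_perm(2)[OF k(2)]] assms(2,3) by metis
    then show "k \<in> {i, j}" using gp3D[OF assms(1,3,4) k(1) assms(5)] by blast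
  qed
qed

lemma pair_in_secants:
  assumes "gp3 P" "r \<notin> P" "i \<in> P" "j \<in> P" "i \<noteq> j" "det3 i j r = 0"
  shows "{i, j} \<in> secants P r"
proof -
  have "{i, j} \<in> lines P r"
    using line_class_pair[OF assms] imageI[OF assms(3), of "line_class P r"] by (simp add: lines_def)
  then show ?thesis using assms(5) by (simp add: secants_def)
qed

lemma lines_card_cases:
  assumes "gp3 P" "r \<notin> P" "c \<in> lines P r"
  shows "card c = 1 \<or> card c = 2"
proof -
  obtain p where p: "p \<in> P" "c = line_class P r p" using assms by (auto simp: lines_def)
  show ?thesis
  proof (cases "\<exists>q\<in>P. q \<noteq> p \<and> det3 r p q = 0")
    case True
    then obtain q where q: "q \<in> P" "q \<noteq> p" "det3 r p q = 0" by blast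
    then have "c = {p, q}"
      using line_class_pair[OF assms(1,2) p(1) q(1) q(2)[symmetric] det3_eq_0_perm(3)[OF q(3)]] p(2) by simp
    then show ?thesis using \<open>q \<noteq> p\<close> by simp
  next
    case False
    then have "c = {p}" using p by (auto simp: line_class_def)
    then show ?thesis by simp
  qed
qed

text \<open>The lines through \<open>r\<close> partition \<open>P\<close> into classes of size one
  or two.\<close>

lemma card_lines_add:
  assumes "finite P" "gp3 P" "r \<notin> P"
  shows "card (lines P r) + card (secants P r) = card P"
proof -
  have fin: "finite (lines P r)" using assms(1) by (rule finite_lines)
  have U: "\<Union> (lines P r) = P" by (auto simp: lines_def line_class_def)
  have "card (\<Union> (lines P r)) = (\<Sum>c\<in>lines P r. card c)"
  proof (rule card_Union_disjoint)
    show "pairwise disjnt (lines P r)"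
      unfolding pairwise_def disjnt_def using lines_disjoint[OF assms(3)] by blast
    show "finite c" if "c \<in> lines P r" for c
      using that assms(1) by (auto simp: lines_def line_class_def)
  qed
  also have "\<dots> = (\<Sum>c\<in>lines P r. 1 + (if card c = 2 then 1 else 0))"
    using lines_card_cases[OF assms(2,3)] by (intro sum.cong) auto
  also have "\<dots> = card (lines P r) + card (secants P r)"
    using fin by (simp only: sum.distrib secants_def card_eq_sum sum.inter_filter)
  finally show ?thesis using U by simp
qed

lemma complement_neq: "A \<subseteq> P \<Longrightarrow> P \<noteq> {} \<Longrightarrow> A \<noteq> P - A"
  by blast

text \<open>The line \<open>rs\<close> passes through both points, so it gives a common bipartition,
  and the complement is a second one. If a point \<open>i\<close> of \<open>P\<close> lies on it,
  the line is tilted about \<open>r\<close> and about \<open>s\<close> so that \<open>i\<close> ends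
  up on the left both times.\<close>

lemma common_cells:
  assumes "finite P" "P \<noteq> {}" "r \<notin> P" "s \<notin> P" "r \<noteq> s"
    and one: "\<And>i j. i \<in> P \<Longrightarrow> j \<in> P \<Longrightarrow> det3 r s i = 0 \<Longrightarrow> det3 r s j = 0 \<Longrightarrow> i = j"
  shows "card (cells P r \<inter> cells P s) \<ge> 2"
proof -
  define u where "u = s - r"
  have u0: "u \<noteq> 0" using assms(5) by (simp add: u_def)
  have rs: "det2 u (k - r) = det3 r s k" "det2 u (k - s) = det3 r s k" for k
    by (simp_all add: u_def det2_def det3_alt algebra_simps)
  have "\<exists>A. A \<in> cells P r \<and> A \<in> cells P s"
  proof (cases "\<exists>k\<in>P. det3 r s k = 0")
    case False
    then have "{k \<in> P. det3 r s k > 0} \<in> cells P r \<and> {k \<in> P. det3 r s k > 0} \<in> cells P s"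
      using left_setI_cells[of P u r] left_setI_cells[of P u s] unfolding rs by blast
    then show ?thesis by blast
  next
    case True
    then obtain i where i: "i \<in> P" "det3 r s i = 0" by blast
    have *: "{k \<in> P. det3 r s k > 0 \<or> k = i} \<in> cells P q" if q: "q \<in> {r, s}" for q
    proof -
      have "q \<notin> P" using q assms by blast
      have e: "det2 u (k - q) = det3 r s k" for k using rs q by auto
      \<comment> \<open>This inner product serves as the parameter \<open>s\<close> of
        \<open>perturbed_cell\<close>: its sign makes the tilt about \<open>q\<close> put
        \<open>i\<close> on the left, on whichever side of \<open>q\<close> it lies.\<close>
      have ne: "u \<bullet> (i - q) \<noteq> 0"
        by (rule det2_parallel_inner) (use e i u0 \<open>q \<notin> P\<close> in auto)
      then have sq: "u \<bullet> (i - q) * (u \<bullet> (i - q)) > 0" using not_real_square_gt_zero by blast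
      have "{k \<in> P. det2 u (k - q) > 0 \<or> (det2 u (k - q) = 0 \<and> u \<bullet> (i - q) * (u \<bullet> (k - q)) > 0)} \<in> cells P q"
        by (rule perturbed_cell[OF assms(1) \<open>q \<notin> P\<close> u0 ne])
      moreover have "{k \<in> P. det2 u (k - q) > 0 \<or> (det2 u (k - q) = 0 \<and> u \<bullet> (i - q) * (u \<bullet> (k - q)) > 0)}
        = {k \<in> P. det3 r s k > 0 \<or> k = i}"
      proof -
        have "det3 r s k = 0 \<and> u \<bullet> (i - q) * (u \<bullet> (k - q)) > 0 \<longleftrightarrow> k = i" if "k \<in> P" for k
          using one[OF i(1) that i(2)] sq i(2) by metis
        then show ?thesis unfolding e by blast
      qed
      ultimately show ?thesis by simp
    qed
    then show ?thesis by blast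
  qed
  then obtain A where A: "A \<in> cells P r" "A \<in> cells P s" by blast
  then have "{A, P - A} \<subseteq> cells P r \<inter> cells P s" using cells_complement by blast
  moreover have "A \<noteq> P - A" using complement_neq[OF cells_subset[OF A(1)] assms(2)] .
  ultimately show ?thesis
    using card_mono[of "cells P r \<inter> cells P s" "{A, P - A}"] finite_cells[OF assms(1)] by simp
qed

subsection \<open>The number of nontrivial bipartitions\<close>

text \<open>A point \<open>p\<close> of largest norm works: the perpendicular to its radius supports
  the disc that contains \<open>P\<close> and touches it only at \<open>p\<close>.\<close>

lemma hull_vertex_exists:
  fixes P :: "(real ^ 2) set"
  assumes "finite P" "P \<noteq> {}"
  obtains p u where "p \<in> P" "\<And>k. k \<in> P \<Longrightarrow> k \<noteq> p \<Longrightarrow> det2 u (k - p) > 0"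
proof -
  obtain p where p: "p \<in> P" "\<And>k. k \<in> P \<Longrightarrow> norm k \<le> norm p"
    using arg_min_if_finite(1)[OF assms, of "\<lambda>k. - norm k"] arg_min_least[OF assms, of _ "\<lambda>k. - norm k"]
    by fastforce
  have "det2 (vector [- p $ 2, p $ 1]) (k - p) > 0" if k: "k \<in> P" "k \<noteq> p" for k
  proof -
    have "(norm k)\<^sup>2 \<le> (norm p)\<^sup>2" using p(2)[OF k(1)] by (simp add: power_mono)
    then have "k \<bullet> k \<le> p \<bullet> p" by (simp add: power2_norm_eq_inner)
    moreover have "(k - p) \<bullet> (k - p) > 0" using k(2) by simp
    ultimately show ?thesis by (simp add: det2_def vector_2 inner2 algebra_simps)
  qed
  then show thesis using that p(1) by blast
qed

definition strict_side :: "(real ^ 2) set \<Rightarrow> real ^ 2 \<Rightarrow> real ^ 2 \<Rightarrow> (real ^ 2) set" where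
  "strict_side P i j = {k \<in> P. det3 i j k > 0}"

text \<open>The bipartitions obtained by shifting the line \<open>ij\<close> slightly, so that \<open>i\<close> and \<open>j\<close> end up on the
  same side.\<close>
definition sides :: "(real ^ 2) set \<Rightarrow> (real ^ 2) set set" where
  "sides P = {A. \<exists>i\<in>P. \<exists>j\<in>P. i \<noteq> j \<and> (A = strict_side P i j \<or> A = P - strict_side P i j)}"

definition nontrivial_sides :: "(real ^ 2) set \<Rightarrow> (real ^ 2) set set" where
  "nontrivial_sides P = {A \<in> sides P. A \<noteq> {} \<and> A \<noteq> P}"

lemma sidesI:
  assumes "i \<in> P" "j \<in> P" "i \<noteq> j"
  shows "strict_side P i j \<in> sides P" "P - strict_side P i j \<in> sides P"
  using assms unfolding sides_def by blast+

lemma sides_subset: "A \<in> sides P \<Longrightarrow> A \<subseteq> P"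
  by (auto simp: sides_def strict_side_def)

lemma finite_nontrivial_sides: "finite P \<Longrightarrow> finite (nontrivial_sides P)"
  by (rule finite_subset[of _ "Pow P"]) (auto simp: nontrivial_sides_def dest: sides_subset)

lemma obtain_min:
  fixes \<phi> :: "'a \<Rightarrow> real"
  assumes "finite A" "A \<noteq> {}"
  obtains m where "m \<in> A" "\<And>k. k \<in> A \<Longrightarrow> \<phi> m \<le> \<phi> k"
  using arg_min_if_finite(1)[OF assms, of \<phi>] arg_min_least[OF assms, of _ \<phi>] by blast

lemma obtain_max:
  fixes \<phi> :: "'a \<Rightarrow> real"
  assumes "finite A" "A \<noteq> {}"
  obtains m where "m \<in> A" "\<And>k. k \<in> A \<Longrightarrow> \<phi> k \<le> \<phi> m"
  using obtain_min[OF assms, of "\<lambda>k. - \<phi> k"] by auto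

text \<open>Deleting a hull vertex \<open>p\<close>: every old bipartition extends over \<open>p\<close>, those cut out by
  lines through \<open>p\<close> extend in both ways.\<close>
lemma nontrivial_sides_step:
  assumes "finite P" "gp3 P" "card P \<ge> 3"
  obtains p F where "p \<in> P" "finite F" "card F = 2 * (card P - 2)"
    "card (nontrivial_sides P) \<ge> card (nontrivial_sides (P - {p}) \<union> F) + 2 + card F"
proof -
  have "P \<noteq> {}" using assms(3) by auto
  then obtain p u where p: "p \<in> P" and u: "\<And>k. k \<in> P \<Longrightarrow> k \<noteq> p \<Longrightarrow> det2 u (k - p) > 0"
    using hull_vertex_exists[OF assms(1)] by blast
  define P' where "P' = P - {p}"
  have fin': "finite P'" and card': "card P' = card P - 1"
    using assms(1) p by (simp_all add: P'_def)
  have ne': "P' \<noteq> {}"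
  proof
    assume "P' = {}"
    then have "card P' = 0" by simp
    then show False using card' assms(3) by linarith
  qed
  define \<phi> where "\<phi> k = cotan u (k - p)" for k
  have d3: "det3 p a k > 0 \<longleftrightarrow> \<phi> k < \<phi> a" "det3 a p k > 0 \<longleftrightarrow> \<phi> a < \<phi> k"
    "det3 p a k = 0 \<longleftrightarrow> \<phi> a = \<phi> k" if "a \<in> P'" "k \<in> P'" for a k
  proof -
    have *: "det2 u (a - p) > 0" "det2 u (k - p) > 0" using that u by (auto simp: P'_def)
    have "det3 a p k = - det3 p a k" by (simp add: det3_alt algebra_simps)
    then show "det3 p a k > 0 \<longleftrightarrow> \<phi> k < \<phi> a" "det3 a p k > 0 \<longleftrightarrow> \<phi> a < \<phi> k"
      "det3 p a k = 0 \<longleftrightarrow> \<phi> a = \<phi> k"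
      using det2_pos_cotan[OF *] by (auto simp: det3_def \<phi>_def)
  qed
  have inj: "a = b" if "a \<in> P'" "b \<in> P'" "\<phi> a = \<phi> b" for a b
    using d3(3)[OF that(1,2)] that gp3D[OF assms(2) p, of a b] by (auto simp: P'_def)
  obtain mn where mn: "mn \<in> P'" "\<And>k. k \<in> P' \<Longrightarrow> \<phi> mn \<le> \<phi> k"
    using obtain_min[OF fin' ne'] by blast
  obtain mx where mx: "mx \<in> P'" "\<And>k. k \<in> P' \<Longrightarrow> \<phi> k \<le> \<phi> mx"
    using obtain_max[OF fin' ne'] by blast
  \<comment> \<open>The initial segments of the angular order about \<open>p\<close>.
    \<open>F\<close> consists of the nontrivial bipartitions of \<open>P'\<close> by lines through
    \<open>p\<close>; leaving out \<open>mx\<close> keeps them nontrivial.\<close>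
  define S where "S a = {k \<in> P'. \<phi> k \<le> \<phi> a}" for a
  define F where "F = S ` (P' - {mx}) \<union> (\<lambda>a. P' - S a) ` (P' - {mx})"
  \<comment> \<open>\<open>X0\<close> and \<open>X1\<close> are the traces on \<open>P'\<close> of
    the nontrivial sides without and with \<open>p\<close>. Their union counts every trace once, and
    their intersection counts the traces that extend over \<open>p\<close> in both ways.\<close>
  define X0 where "X0 = {A \<in> nontrivial_sides P. p \<notin> A}"
  define X1 where "X1 = {A. p \<notin> A \<and> insert p A \<in> nontrivial_sides P}"
  have finn: "finite (nontrivial_sides P)" using assms(1) by (rule finite_nontrivial_sides)
  have sub: "A \<subseteq> P" if "A \<in> nontrivial_sides P" for A using that sides_subset by (auto simp: nontrivial_sides_def)
  have fX0: "finite X0" using finn by (simp add: X0_def)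
  have X1im: "X1 = (\<lambda>A. A - {p}) ` {A \<in> nontrivial_sides P. p \<in> A}"
    unfolding X1_def image_def by (auto simp: insert_absorb)
  have fX1: "finite X1" unfolding X1im using finn by simp
  have "inj_on (\<lambda>A. A - {p}) {A \<in> nontrivial_sides P. p \<in> A}"
    by (auto simp: inj_on_def)
  then have cX1: "card X1 = card {A \<in> nontrivial_sides P. p \<in> A}" unfolding X1im by (rule card_image)
  have "card (nontrivial_sides P) = card X0 + card {A \<in> nontrivial_sides P. p \<in> A}"
    unfolding X0_def using finn
    by (subst card_Un_disjoint[symmetric]) (auto intro!: arg_cong[of _ _ card])
  also have "\<dots> = card (X0 \<union> X1) + card (X0 \<inter> X1)"
    using card_Un_Int[OF fX0 fX1] cX1 by simp
  finally have split: "card (nontrivial_sides P) = card (X0 \<union> X1) + card (X0 \<inter> X1)" .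
  have Fsub: "F \<subseteq> X0 \<inter> X1"
  proof -
    have "S a \<in> X0 \<inter> X1 \<and> P' - S a \<in> X0 \<inter> X1" if a: "a \<in> P'" "a \<noteq> mx" for a
    proof -
      have amx: "\<phi> a < \<phi> mx" using mx inj a by (metis order_le_less)
      have "{k \<in> P'. \<phi> a < \<phi> k} \<noteq> {}" using mx amx by blast
      have "finite {k \<in> P'. \<phi> a < \<phi> k}" using fin' by simp
      from obtain_min[OF this \<open>{k \<in> P'. \<phi> a < \<phi> k} \<noteq> {}\<close>, of \<phi>] obtain b where "b \<in> {k \<in> P'. \<phi> a < \<phi> k}"
        "\<And>k. k \<in> {k \<in> P'. \<phi> a < \<phi> k} \<Longrightarrow> \<phi> b \<le> \<phi> k"
        by blast
      then have b: "b \<in> P'" "\<phi> a < \<phi> b" "\<And>k. k \<in> P' \<Longrightarrow> \<phi> a < \<phi> k \<Longrightarrow> \<phi> b \<le> \<phi> k"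
        by blast+
      \<comment> \<open>\<open>b\<close> is the successor of \<open>a\<close> in the angular order.
        So both \<open>S a\<close> and its complement in \<open>P'\<close> are strict sides of lines
        through \<open>p\<close>, and their complements in \<open>P\<close> contain
        \<open>p\<close>.\<close>
      have 1: "strict_side P p b = S a"
        unfolding strict_side_def S_def using d3(1)[OF b(1)] b by (force simp: P'_def)
      have 2: "strict_side P a p = P' - S a"
        unfolding strict_side_def S_def using d3(2)[OF a(1)] by (force simp: P'_def)
      have pS: "p \<notin> S a" "S a \<subseteq> P'" by (auto simp: S_def P'_def)
      have in4: "S a \<in> sides P" "P - S a \<in> sides P" "P' - S a \<in> sides P" "P - (P' - S a) \<in> sides P"
        using sidesI[of p P b] sidesI[of a P p] p a b unfolding 1 2 by (auto simp: P'_def)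
      have "insert p (S a) = P - (P' - S a)" "insert p (P' - S a) = P - S a"
        using pS p by (auto simp: P'_def)
      moreover have "a \<in> S a" "mx \<notin> S a" using a amx by (auto simp: S_def)
      ultimately show ?thesis
        using in4 pS a mx(1) p unfolding X0_def X1_def nontrivial_sides_def P'_def by auto
    qed
    then show ?thesis unfolding F_def by blast
  qed
  have cardF: "card F = 2 * (card P - 2)"
  proof -
    have mnS: "mn \<in> S a" if "a \<in> P'" for a using that mn by (simp add: S_def)
    have i1: "inj_on S (P' - {mx})"
    proof (rule inj_onI)
      fix a b assume ab: "a \<in> P' - {mx}" "b \<in> P' - {mx}" "S a = S b"
      then have "a \<in> S b" "b \<in> S a" by (auto simp: S_def)
      then show "a = b" using inj[of a b] ab by (auto simp: S_def)
    qed
    have i2: "inj_on (\<lambda>a. P' - S a) (P' - {mx})"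
    proof (rule inj_onI)
      fix a b assume ab: "a \<in> P' - {mx}" "b \<in> P' - {mx}" "P' - S a = P' - S b"
      then have "S a = S b" by (auto simp: S_def)
      then show "a = b" using i1 ab by (auto dest: inj_onD)
    qed
    have "S ` (P' - {mx}) \<inter> (\<lambda>a. P' - S a) ` (P' - {mx}) = {}"
      using mnS by blast
    then have "card F = card (P' - {mx}) + card (P' - {mx})"
      unfolding F_def using fin' card_image[OF i1] card_image[OF i2] by (subst card_Un_disjoint) auto
    then show ?thesis using card' mx(1) by simp
  qed
  have "finite F" using fin' by (simp add: F_def)
  \<comment> \<open>The trivial bipartition of \<open>P'\<close> extends to the nontrivial one that
    separates \<open>p\<close>. It is cut out by an edge \<open>x mn\<close> of the hull of
    \<open>P'\<close> that has \<open>p\<close> alone beyond it. This gives the two extra traces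
    \<open>{}\<close> and \<open>P'\<close>.\<close>
  have emp: "{} \<in> X1 \<and> P' \<in> X0"
  proof -
    have "P' - {mn} \<noteq> {}"
      using card' assms(3) mn(1) card_mono[of "{mn}" P'] by auto
    have w: "det2 (mn - p) (k - mn) < 0" if "k \<in> P' - {mn}" for k
    proof -
      have "\<phi> mn < \<phi> k" using that mn inj by (metis DiffE insertI1 order_le_less)
      then have "det3 mn p k > 0" using d3(2) mn(1) that by auto
      then show ?thesis by (simp add: det3_alt det2_def algebra_simps)
    qed
    define \<psi> where "\<psi> k = cotan (p - mn) (k - mn)" for k
    obtain x where x: "x \<in> P' - {mn}" "\<And>k. k \<in> P' - {mn} \<Longrightarrow> \<psi> k \<le> \<psi> x"
      using obtain_max[OF finite_Diff[OF fin'] \<open>P' - {mn} \<noteq> {}\<close>, of \<psi>] by blast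
    have w': "det2 (p - mn) (k - mn) > 0" if "k \<in> P' - {mn}" for k
      using w[OF that] det2_uminus(1)[of "mn - p" "k - mn"] by simp
    have "det3 mn x p < 0"
      using w'[OF x(1)] by (simp add: det3_alt det2_def algebra_simps)
    moreover have "det3 mn x k \<ge> 0" if "k \<in> P'" for k
    proof (cases "k = mn")
      case False
      then have k: "k \<in> P' - {mn}" using that by simp
      show ?thesis
        using det2_pos_cotan(3)[OF w'[OF x(1)] w'[OF k]] x(2)[OF k] unfolding \<psi>_def det3_def by linarith
    qed simp
    moreover have "det3 x mn k = - det3 mn x k" for k by (simp add: det3_alt algebra_simps)
    ultimately have "strict_side P x mn = {p}"
      using p unfolding strict_side_def P'_def by force
    then have "{p} \<in> sides P" "P' \<in> sides P"
      using sidesI[of x P mn] x(1) mn(1) by (auto simp: P'_def)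
    then show ?thesis
      using ne' p unfolding X0_def X1_def nontrivial_sides_def P'_def by auto
  qed
  have old: "nontrivial_sides P' \<subseteq> X0 \<union> X1"
  proof
    fix A assume "A \<in> nontrivial_sides P'"
    then obtain i j where ij: "i \<in> P'" "j \<in> P'" "i \<noteq> j" "A = strict_side P' i j \<or> A = P' - strict_side P' i j"
      and A: "A \<noteq> {}" "A \<noteq> P'"
      by (auto simp: nontrivial_sides_def sides_def)
    have ij': "i \<in> P" "j \<in> P" using ij by (auto simp: P'_def)
    have pA: "p \<notin> A" "A \<subseteq> P'" using ij by (auto simp: strict_side_def P'_def)
    have "A \<in> sides P \<or> insert p A \<in> sides P"
    proof (cases "det3 i j p > 0")
      case True
      then have "strict_side P i j = insert p (strict_side P' i j)"
        using p by (auto simp: strict_side_def P'_def)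
      moreover from this have "P - strict_side P i j = P' - strict_side P' i j"
        by (auto simp: P'_def)
      ultimately show ?thesis using ij(4) sidesI[OF ij' ij(3)] by auto
    next
      case False
      then have *: "strict_side P i j = strict_side P' i j"
        by (auto simp: strict_side_def P'_def)
      moreover have "P - strict_side P i j = insert p (P' - strict_side P' i j)"
        using False p by (auto simp: P'_def strict_side_def)
      ultimately show ?thesis using ij(4) sidesI[OF ij' ij(3)] by auto
    qed
    then show "A \<in> X0 \<union> X1"
      using pA A p unfolding X0_def X1_def nontrivial_sides_def P'_def by auto
  qed
  have "{} \<notin> nontrivial_sides P'" "P' \<notin> nontrivial_sides P'" by (auto simp: nontrivial_sides_def)
  moreover have "{} \<notin> F" "P' \<notin> F"
    using Fsub by (auto simp: X0_def X1_def nontrivial_sides_def P'_def p insert_absorb)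
  moreover have fU: "finite (nontrivial_sides P' \<union> F)" using finite_nontrivial_sides[OF fin'] \<open>finite F\<close> by simp
  ultimately have "card (insert {} (insert P' (nontrivial_sides P' \<union> F))) = card (nontrivial_sides P' \<union> F) + 2"
    using ne' by auto
  moreover have "insert {} (insert P' (nontrivial_sides P' \<union> F)) \<subseteq> X0 \<union> X1"
    using emp old Fsub by blast
  ultimately have "card (nontrivial_sides P' \<union> F) + 2 \<le> card (X0 \<union> X1)"
    using card_mono[of "X0 \<union> X1"] fX0 fX1 by (metis finite_UnI)
  moreover have "card F \<le> card (X0 \<inter> X1)"
    using Fsub fX0 by (intro card_mono) auto
  ultimately show thesis
    using that[of p F] p \<open>finite F\<close> cardF split by (simp add: P'_def)
qed

text \<open>Induction by removing hull vertices: from \<open>n\<close> to \<open>n + 1\<close>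
  points the gain is \<open>2 + 2 * (n - 1) = 2 * n\<close>. For three points, \<open>F\<close> has
  two elements and the step gives \<open>2 + 2 + 2\<close>.\<close>

lemma card_nontrivial_sides:
  assumes "finite P" "gp3 P" "card P \<ge> 3"
  shows "card (nontrivial_sides P) \<ge> card P * (card P - 1)"
proof -
  have "card (nontrivial_sides P) \<ge> n * (n - 1)" if "n \<ge> 3" "card P = n" "finite P" "gp3 P" for n and P :: "(real ^ 2) set"
    using that
  proof (induction n arbitrary: P rule: nat_induct_at_least)
    case base
    have "card P \<ge> 3" using base by simp
    from nontrivial_sides_step[OF base(2,3) this]
    obtain p F where *: "finite F" "card F = 2 * (card P - 2)"
      "card (nontrivial_sides P) \<ge> card (nontrivial_sides (P - {p}) \<union> F) + 2 + card F" .
    have "card F \<le> card (nontrivial_sides (P - {p}) \<union> F)"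
      using *(1) base finite_nontrivial_sides[of "P - {p}"] by (intro card_mono) auto
    then show ?case using * base by simp
  next
    case (Suc n)
    have "card P \<ge> 3" using Suc by simp
    from nontrivial_sides_step[OF Suc.prems(2,3) this]
    obtain p F where *: "p \<in> P" "finite F" "card F = 2 * (card P - 2)"
      "card (nontrivial_sides P) \<ge> card (nontrivial_sides (P - {p}) \<union> F) + 2 + card F" .
    have "gp3 (P - {p})" using Suc.prems(3) by (auto simp: gp3_def)
    then have "n * (n - 1) \<le> card (nontrivial_sides (P - {p}))"
      using Suc.prems *(1) by (intro Suc.IH) auto
    also have "\<dots> \<le> card (nontrivial_sides (P - {p}) \<union> F)"
      using *(2) Suc.prems finite_nontrivial_sides[of "P - {p}"] by (intro card_mono) auto
    finally have "card (nontrivial_sides P) \<ge> n * (n - 1) + 2 + 2 * (n - 1)"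
      using * Suc.prems by simp
    moreover obtain m where "n = Suc m" using Suc.hyps by (cases n) auto
    ultimately show ?case by (simp add: algebra_simps)
  qed
  then show ?thesis using assms by blast
qed

subsection \<open>Every blocking point is exterior\<close>

text \<open>For a point \<open>r\<close> on the line \<open>xy\<close>, the inner product condition
  says that \<open>x\<close> and \<open>y\<close> lie on the same side of \<open>r\<close>, that is,
  \<open>r\<close> is outside the segment.\<close>

locale blocked_set =
  fixes P R :: "(real ^ 2) set" and n :: nat
  assumes finP: "finite P" and cardP: "card P = n" and gp: "gp3 P"
    and finR: "finite R" and cardR: "card R = n" and disj: "P \<inter> R = {}" and n3: "n \<ge> 3"
    and blocked: "x \<in> P \<Longrightarrow> y \<in> P \<Longrightarrow> x \<noteq> y \<Longrightarrow> \<exists>r\<in>R. det3 x y r = 0 \<and> (x - r) \<bullet> (y - r) > 0"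
begin

lemma P_ne: "P \<noteq> {}"
  using cardP n3 by auto

lemma R_notin: "r \<in> R \<Longrightarrow> r \<notin> P"
  using disj by auto

text \<open>Since \<open>i\<close> and \<open>j\<close> lie on the same side of \<open>r\<close>, a
  slight turn of the line \<open>ij\<close> about \<open>r\<close> moves both to its right and
  leaves all other points of \<open>P\<close> on their sides.\<close>

lemma strict_side_in_cells:
  assumes "i \<in> P" "j \<in> P" "i \<noteq> j" "r \<in> R" "det3 i j r = 0" "(i - r) \<bullet> (j - r) > 0"
  shows "strict_side P i j \<in> cells P r"
proof -
  define u where "u = j - i"
  have u0: "u \<noteq> 0" using assms(3) by (simp add: u_def)
  have u: "det2 u (k - r) = det3 i j k" for k
    using assms(5) unfolding u_def det3_alt det2_def by (simp add: algebra_simps)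
  have "u \<bullet> (i - r) * (u \<bullet> (j - r)) + det2 u (i - r) * det2 u (j - r) = (u \<bullet> u) * ((i - r) \<bullet> (j - r))"
    by (simp add: inner2 det2_def algebra_simps)
  then have "u \<bullet> (i - r) * (u \<bullet> (j - r)) = (u \<bullet> u) * ((i - r) \<bullet> (j - r))" by (simp add: u)
  moreover have "u \<bullet> u > 0" using u0 by simp
  ultimately have pos: "u \<bullet> (i - r) * (u \<bullet> (j - r)) > 0" using assms(6) by (metis mult_pos_pos)
  then have s0: "- (u \<bullet> (i - r)) \<noteq> 0" by auto
  have sq: "u \<bullet> (i - r) * (u \<bullet> (i - r)) \<ge> 0" by simp
  have "{k \<in> P. det2 u (k - r) > 0 \<or> (det2 u (k - r) = 0 \<and> - (u \<bullet> (i - r)) * (u \<bullet> (k - r)) > 0)} \<in> cells P r"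
    by (rule perturbed_cell[OF finP R_notin[OF assms(4)] u0 s0])
  moreover have "\<not> (det3 i j k = 0 \<and> - (u \<bullet> (i - r)) * (u \<bullet> (k - r)) > 0)" if "k \<in> P" for k
  proof
    assume *: "det3 i j k = 0 \<and> - (u \<bullet> (i - r)) * (u \<bullet> (k - r)) > 0"
    then have "k = i \<or> k = j" using gp3D[OF gp assms(1,2) that assms(3)] by blast
    then show False using * pos sq by auto
  qed
  ultimately have "{k \<in> P. det3 i j k > 0} \<in> cells P r"
    unfolding u by (metis (mono_tags, lifting) Collect_cong)
  then show ?thesis by (simp add: strict_side_def)
qed

text \<open>The blocking points on the two hull edges at a hull vertex.\<close>
lemma two_exterior:
  obtains r r' where "r \<in> R" "r' \<in> R" "r \<noteq> r'" "{} \<in> cells P r" "{} \<in> cells P r'"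
proof -
  obtain p u where p: "p \<in> P" and u: "\<And>k. k \<in> P \<Longrightarrow> k \<noteq> p \<Longrightarrow> det2 u (k - p) > 0"
    using hull_vertex_exists[OF finP P_ne] by blast
  define \<phi> where "\<phi> k = cotan u (k - p)" for k
  have "card (P - {p}) \<ge> 2" using p cardP n3 finP by simp
  then have ne: "P - {p} \<noteq> {}" by (metis card.empty not_numeral_le_zero)
  have fin: "finite (P - {p})" using finP by simp
  obtain a where a: "a \<in> P - {p}" "\<And>k. k \<in> P - {p} \<Longrightarrow> \<phi> a \<le> \<phi> k"
    using obtain_min[OF fin ne, of \<phi>] by blast
  obtain b where b: "b \<in> P - {p}" "\<And>k. k \<in> P - {p} \<Longrightarrow> \<phi> k \<le> \<phi> b"
    using obtain_max[OF fin ne, of \<phi>] by blast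
  have d3: "det3 p x k > 0 \<longleftrightarrow> \<phi> k < \<phi> x" "det3 p x k = 0 \<longleftrightarrow> \<phi> x = \<phi> k"
    if "x \<in> P - {p}" "k \<in> P - {p}" for x k
    using det2_pos_cotan[of u "x - p" "k - p"] u that unfolding det3_def \<phi>_def by auto
  have "a \<noteq> b"
  proof
    assume "a = b"
    then have "\<phi> k = \<phi> a" if "k \<in> P - {p}" for k using a(2)[OF that] b(2)[OF that] by simp
    then have "det3 p a k = 0" if "k \<in> P - {p}" for k using d3(2) a(1) that by metis
    then have "P - {p} \<subseteq> {a}" using gp3D[OF gp p, of a] a(1) by blast
    then have "card (P - {p}) \<le> 1" using card_mono[of "{a}" "P - {p}"] by simp
    then show False using \<open>card (P - {p}) \<ge> 2\<close> by simp
  qed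
  have 1: "strict_side P p a = {}"
    using a d3(1)[OF a(1)] unfolding strict_side_def by (force simp: not_less)
  have 2: "strict_side P b p = {}"
  proof -
    have "\<not> det3 b p k > 0" if "k \<in> P - {p}" for k
    proof
      assume "det3 b p k > 0"
      then have "det3 p b k < 0" by (simp add: det3_alt algebra_simps)
      then show False using d3[OF b(1) that] b(2)[OF that] by linarith
    qed
    then show ?thesis unfolding strict_side_def by force
  qed
  obtain r where r: "r \<in> R" "det3 p a r = 0" "(p - r) \<bullet> (a - r) > 0"
    using blocked[OF p, of a] a(1) by blast
  obtain r' where r': "r' \<in> R" "det3 b p r' = 0" "(b - r') \<bullet> (p - r') > 0"
    using blocked[OF _ p, of b] b(1) by blast
  have "{} \<in> cells P r" using strict_side_in_cells[OF p _ _ r] a(1) 1 by auto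
  moreover have "{} \<in> cells P r'" using strict_side_in_cells[OF _ p _ r'] b(1) 2 by auto
  moreover have "r \<noteq> r'"
  proof
    assume "r = r'"
    then have "det3 b p a = 0" using lines_corner[of b p r a] r r' R_notin p by auto
    then show False using gp3D[OF gp, of b p a] a(1) b(1) p \<open>a \<noteq> b\<close> by auto
  qed
  ultimately show thesis using that r(1) r'(1) by blast
qed

section \<open>Double counting of incidences and bipartitions\<close>

definition incidences :: nat where
  "incidences = (\<Sum>r\<in>R. card (secants P r))"

definition pairs :: "(real ^ 2) set set" where
  "pairs = {e. e \<subseteq> P \<and> card e = 2}"

lemma finite_pairs: "finite pairs"
  using finP by (simp add: pairs_def)

lemma card_pairs: "card pairs = n choose 2"
  unfolding pairs_def using n_subsets[OF finP] cardP by simp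

lemma finite_secants: "finite (secants P r)"
  using finite_lines[OF finP] by (simp add: secants_def)

lemma sum_card_lines: "(\<Sum>r\<in>R. card (lines P r)) + incidences = n * n"
proof -
  have "(\<Sum>r\<in>R. card (lines P r)) + incidences = (\<Sum>r\<in>R. card P)"
    unfolding incidences_def sum.distrib[symmetric]
    by (intro sum.cong refl card_lines_add finP gp R_notin)
  then show ?thesis using cardP cardR by simp
qed

lemma pair_blocked:
  assumes "e \<in> pairs" shows "\<exists>r\<in>R. e \<in> secants P r"
proof -
  obtain i j where "e = {i, j}" "i \<noteq> j" using assms by (auto simp: pairs_def card_2_iff)
  then show ?thesis
    using blocked[of i j] pair_in_secants[OF gp, of _ i j] R_notin assms unfolding pairs_def by blast
qed

text \<open>The points \<open>s\<close> whose line with \<open>r0\<close> carries two points of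
  \<open>P\<close>. \<open>common_cells\<close> does not apply to them; in exchange each one gives
  an incidence beyond one per pair.\<close>

definition aligned :: "real ^ 2 \<Rightarrow> (real ^ 2) set" where
  "aligned r0 = {s \<in> R - {r0}. \<exists>e. e \<in> secants P s \<and> e \<in> secants P r0}"

lemma incidences_ge:
  assumes "r0 \<in> R"
  shows "(n choose 2) + card (aligned r0) \<le> incidences"
proof -
  define e where "e s = (SOME e. e \<in> secants P s \<and> e \<in> secants P r0)" for s
  have e: "e s \<in> secants P s" "e s \<in> secants P r0" if "s \<in> aligned r0" for s
    using that someI_ex[of "\<lambda>e. e \<in> secants P s \<and> e \<in> secants P r0"] by (auto simp: aligned_def e_def)
  \<comment> \<open>Each pair is assigned to one blocking point, to \<open>r0\<close> whenever
    possible. A pair shared by \<open>r0\<close> and an aligned \<open>s\<close> is therefore never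
    assigned to \<open>s\<close>, and its incidence with \<open>s\<close> is new.\<close>
  define c where "c e = (if e \<in> secants P r0 then r0 else (SOME r. r \<in> R \<and> e \<in> secants P r))" for e
  have c: "c e \<in> R \<and> e \<in> secants P (c e)" if "e \<in> pairs" for e
    using pair_blocked[OF that] someI_ex[of "\<lambda>r. r \<in> R \<and> e \<in> secants P r"] assms by (auto simp: c_def)
  define A where "A = (\<lambda>e. (c e, e)) ` pairs"
  define B where "B = (\<lambda>s. (s, e s)) ` aligned r0"
  have finB: "finite (aligned r0)" using finR by (simp add: aligned_def)
  have "A \<inter> B = {}"
  proof -
    have False if "e' \<in> pairs" "s \<in> aligned r0" "c e' = s" "e' = e s" for e' s
      using that e[OF that(2)] by (auto simp: c_def aligned_def)
    then show ?thesis unfolding A_def B_def by blast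
  qed
  then have "card (A \<union> B) = card A + card B"
    using finite_pairs finB by (intro card_Un_disjoint) (auto simp: A_def B_def)
  moreover have "card A = n choose 2"
    unfolding A_def by (subst card_image) (auto simp: inj_on_def card_pairs)
  moreover have "card B = card (aligned r0)"
    unfolding B_def by (subst card_image) (auto simp: inj_on_def)
  moreover have "A \<union> B \<subseteq> Sigma R (secants P)"
    using c e by (auto simp: A_def B_def aligned_def)
  then have "card (A \<union> B) \<le> card (Sigma R (secants P))"
    using finR finite_secants by (intro card_mono) auto
  moreover have "card (Sigma R (secants P)) = incidences"
    unfolding incidences_def using finR finite_secants by (intro card_SigmaI) auto
  ultimately show ?thesis by simp
qed

definition all_cells :: "(real ^ 2) set set" where
  "all_cells = (\<Union>r\<in>R. cells P r)"

definition cell_mult :: "(real ^ 2) set \<Rightarrow> nat" where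
  "cell_mult A = card {r \<in> R. A \<in> cells P r}"

lemma finite_all_cells: "finite all_cells"
  using finR finite_cells[OF finP] by (simp add: all_cells_def)

lemma cell_mult_pos: "A \<in> all_cells \<Longrightarrow> cell_mult A \<ge> 1"
  unfolding cell_mult_def all_cells_def using finR by (auto simp: Suc_le_eq card_gt_0_iff)

lemma sum_cell_mult: "(\<Sum>A\<in>all_cells. cell_mult A) = (\<Sum>r\<in>R. card (cells P r))"
proof -
  have "(\<Sum>r\<in>R. card {A \<in> all_cells. A \<in> cells P r}) = (\<Sum>A\<in>all_cells. cell_mult A)"
    by (rule sum_multicount_gen) (auto simp: finR finite_all_cells cell_mult_def)
  moreover have "{A \<in> all_cells. A \<in> cells P r} = cells P r" if "r \<in> R" for r
    using that by (auto simp: all_cells_def)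
  ultimately show ?thesis by simp
qed

text \<open>Every secant through a point of \<open>R\<close> lowers the bound \<open>2 * n\<close>
  on the number of its cells by two.\<close>

lemma sum_cell_mult_le: "(\<Sum>A\<in>all_cells. cell_mult A) + 2 * incidences \<le> 2 * (n * n)"
proof -
  have "(\<Sum>r\<in>R. card (cells P r)) \<le> (\<Sum>r\<in>R. 2 * card (lines P r))"
    by (intro sum_mono card_cells_le finP P_ne R_notin)
  also have "\<dots> = 2 * (\<Sum>r\<in>R. card (lines P r))" by (simp add: sum_distrib_left)
  finally show ?thesis using sum_card_lines sum_cell_mult by simp
qed

lemma nontrivial_sides_all_cells: "nontrivial_sides P \<subseteq> all_cells"
proof
  fix A assume "A \<in> nontrivial_sides P"
  then obtain i j where ij: "i \<in> P" "j \<in> P" "i \<noteq> j" "A = strict_side P i j \<or> A = P - strict_side P i j"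
    by (auto simp: nontrivial_sides_def sides_def)
  obtain r where r: "r \<in> R" "det3 i j r = 0" "(i - r) \<bullet> (j - r) > 0" using blocked[OF ij(1-3)] by blast
  show "A \<in> all_cells"
    using strict_side_in_cells[OF ij(1-3) r] cells_complement ij(4) r(1) unfolding all_cells_def by blast
qed

lemma trivial_all_cells: "{} \<in> all_cells" "P \<in> all_cells"
proof -
  obtain r where "r \<in> R" "{} \<in> cells P r" using two_exterior by blast
  then show "{} \<in> all_cells" "P \<in> all_cells"
    using cells_complement[of "{}" P r] by (auto simp: all_cells_def)
qed

lemma card_all_cells: "card all_cells \<ge> n * (n - 1) + 2"
proof -
  have "card (insert {} (insert P (nontrivial_sides P))) = card (nontrivial_sides P) + 2"
    using P_ne finite_nontrivial_sides[OF finP] by (subst card_insert_disjoint; auto simp: nontrivial_sides_def)+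
  moreover have "insert {} (insert P (nontrivial_sides P)) \<subseteq> all_cells"
    using nontrivial_sides_all_cells trivial_all_cells by blast
  then have "card (insert {} (insert P (nontrivial_sides P))) \<le> card all_cells"
    by (rule card_mono[OF finite_all_cells])
  moreover have "n * (n - 1) \<le> card (nontrivial_sides P)"
    using card_nontrivial_sides[OF finP gp] cardP n3 by simp
  ultimately show ?thesis by linarith
qed

lemma cell_mult_full: "cell_mult P = cell_mult {}"
proof -
  have "P \<in> cells P r \<longleftrightarrow> {} \<in> cells P r" for r
    using cells_complement[of P P r] cells_complement[of "{}" P r] by auto
  then show ?thesis by (simp add: cell_mult_def)
qed

lemma common_cells_ge:
  assumes "r0 \<in> R" "s \<in> R - {r0} - aligned r0"
  shows "card {A \<in> cells P r0. A \<in> cells P s} \<ge> 2"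
proof -
  have "card (cells P r0 \<inter> cells P s) \<ge> 2"
  proof (rule common_cells[OF finP P_ne])
    show "r0 \<notin> P" "s \<notin> P" "r0 \<noteq> s" using assms R_notin by auto
    fix i j assume ij: "i \<in> P" "j \<in> P" "det3 r0 s i = 0" "det3 r0 s j = 0"
    show "i = j"
    proof (rule ccontr)
      assume "i \<noteq> j"
      have "det3 i j r0 = 0" "det3 i j s = 0"
        using det3_common_line[OF ij(3,4), of r0] det3_common_line[OF ij(3,4), of s] \<open>r0 \<noteq> s\<close> by auto
      then have "{i, j} \<in> secants P r0" "{i, j} \<in> secants P s"
        using pair_in_secants[OF gp _ ij(1,2) \<open>i \<noteq> j\<close>] \<open>r0 \<notin> P\<close> \<open>s \<notin> P\<close> by auto
      then show False using assms(2) by (auto simp: aligned_def)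
    qed
  qed
  then show ?thesis by (simp add: Int_def)
qed

text \<open>A point of \<open>R\<close> inside the hull would share a nontrivial bipartition with (almost) every other
  point of \<open>R\<close>, more than the excess of \<open>sum_cell_mult_le\<close> over \<open>card_all_cells\<close> permits.\<close>
lemma all_exterior:
  assumes r0: "r0 \<in> R" shows "{} \<in> cells P r0"
proof (rule ccontr)
  assume no: "{} \<notin> cells P r0"
  then have noP: "P \<notin> cells P r0" using cells_complement[of P P r0] by auto
  obtain r r' where r: "r \<in> R" "r' \<in> R" "r \<noteq> r'" "{} \<in> cells P r" "{} \<in> cells P r'"
    using two_exterior by blast
  then have "card {r, r'} \<le> cell_mult {}"
    unfolding cell_mult_def using finR by (intro card_mono) auto
  then have m2: "cell_mult {} \<ge> 2" using r(3) by simp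
  \<comment> \<open>The surplus multiplicity. On a cell of \<open>r0\<close> it counts the other
    points of \<open>R\<close> that share the cell; \<open>{}\<close> and \<open>P\<close>, which
    are not cells of \<open>r0\<close>, add at least two more.\<close>
  define g where "g A = cell_mult A - 1" for A
  have "(\<Sum>A\<in>all_cells. cell_mult A) = (\<Sum>A\<in>all_cells. 1 + g A)"
    using cell_mult_pos by (intro sum.cong refl) (force simp: g_def)
  also have "\<dots> = card all_cells + (\<Sum>A\<in>all_cells. g A)"
    by (simp only: sum.distrib card_eq_sum)
  finally have 1: "(\<Sum>A\<in>all_cells. cell_mult A) = card all_cells + (\<Sum>A\<in>all_cells. g A)" .
  have fin0: "finite (cells P r0)" by (rule finite_cells[OF finP])
  have "(\<Sum>A\<in>cells P r0. g A) + 2 \<le> (\<Sum>A\<in>insert {} (insert P (cells P r0)). g A)"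
    using no noP P_ne fin0 m2 cell_mult_full by (simp add: g_def)
  also have "\<dots> \<le> (\<Sum>A\<in>all_cells. g A)"
    using trivial_all_cells r0 by (intro sum_mono2 finite_all_cells) (auto simp: all_cells_def)
  finally have 2: "(\<Sum>A\<in>cells P r0. g A) + 2 \<le> (\<Sum>A\<in>all_cells. g A)" .
  have g: "g A = card {s \<in> R - {r0}. A \<in> cells P s}" if "A \<in> cells P r0" for A
  proof -
    have "{r \<in> R. A \<in> cells P r} = insert r0 {s \<in> R - {r0}. A \<in> cells P s}" using that r0 by auto
    then show ?thesis using finR by (simp add: g_def cell_mult_def)
  qed
  have "2 * card (R - {r0} - aligned r0) = (\<Sum>s\<in>R - {r0} - aligned r0. 2)" by simp
  also have "\<dots> \<le> (\<Sum>s\<in>R - {r0} - aligned r0. card {A \<in> cells P r0. A \<in> cells P s})"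
    by (intro sum_mono common_cells_ge r0)
  also have "\<dots> \<le> (\<Sum>s\<in>R - {r0}. card {A \<in> cells P r0. A \<in> cells P s})"
    using finR by (intro sum_mono2) auto
  also have "\<dots> = (\<Sum>A\<in>cells P r0. g A)"
    by (rule sum_multicount_gen) (use finR fin0 g in auto)
  finally have 3: "2 * card (R - {r0} - aligned r0) \<le> (\<Sum>A\<in>cells P r0. g A)" .
  have "aligned r0 \<subseteq> R - {r0}" by (auto simp: aligned_def)
  then have "card (R - {r0} - aligned r0) + card (aligned r0) = n - 1"
    using finR r0 cardR card_mono[of "R - {r0}" "aligned r0"]
    by (subst card_Diff_subset) (auto intro: finite_subset)
  moreover have "2 * (n choose 2) = n * (n - 1)"
    using times_binomial_minus1_eq[of 2 n] by simp
  moreover have "n * (n - 1) + n = n * n" using n3 by (cases n) auto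
  \<comment> \<open>With \<open>a = card (aligned r0)\<close> the multiplicities sum to at least
    \<open>n * (n - 1) + 2 + 2 + 2 * (n - 1 - a) = n * n + n + 2 - 2 * a\<close>, but
    \<open>incidences_ge\<close> bounds the sum by \<open>n * n + n - 2 * a\<close>.\<close>
  ultimately show False
    using 1 2 3 sum_cell_mult_le card_all_cells incidences_ge[OF r0] n3 by linarith
qed

text \<open>By \<open>all_exterior\<close> both trivial bipartitions have multiplicity
  \<open>n\<close>, so the multiplicities sum to at least \<open>n * (n - 1) + 2 * n\<close>. This
  already equals the upper bound for \<open>n choose 2\<close> incidences; a pair blocked twice
  would lower that bound by two.\<close>

lemma unique_blocker:
  assumes "r \<in> R" "s \<in> R" "e \<in> secants P r" "e \<in> secants P s"
  shows "r = s"
proof (rule ccontr)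
  assume "r \<noteq> s"
  then have "s \<in> aligned r" using assms by (auto simp: aligned_def)
  moreover have "finite (aligned r)" using finR by (simp add: aligned_def)
  ultimately have "card (aligned r) \<ge> 1" by (metis card_gt_0_iff empty_iff Suc_le_eq One_nat_def)
  then have inc: "(n choose 2) + 1 \<le> incidences" using incidences_ge[OF assms(1)] by linarith
  have "cell_mult {} = n" unfolding cell_mult_def using all_exterior cardR by (metis (no_types, lifting) Collect_cong Collect_mem_eq)
  then have mP: "cell_mult {} = n" "cell_mult P = n" using cell_mult_full by auto
  have "card all_cells - 2 + 2 * n \<le> (\<Sum>A\<in>all_cells - {{}, P}. cell_mult A) + (cell_mult {} + cell_mult P)"
  proof -
    have "card (all_cells - {{}, P}) = card all_cells - 2"
      using trivial_all_cells P_ne finite_all_cells by (subst card_Diff_subset) auto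
    moreover have "card (all_cells - {{}, P}) * 1 \<le> (\<Sum>A\<in>all_cells - {{}, P}. cell_mult A)"
      using cell_mult_pos sum_bounded_below[of "all_cells - {{}, P}" 1 cell_mult] by auto
    ultimately show ?thesis using mP by simp
  qed
  also have "\<dots> = (\<Sum>A\<in>all_cells. cell_mult A)"
    using sum.subset_diff[of "{{}, P}" all_cells cell_mult] trivial_all_cells P_ne finite_all_cells by simp
  finally have "card all_cells - 2 + 2 * n \<le> (\<Sum>A\<in>all_cells. cell_mult A)" .
  moreover have "2 * (n choose 2) = n * (n - 1)"
    using times_binomial_minus1_eq[of 2 n] by simp
  moreover have "n * (n - 1) + n = n * n" using n3 by (cases n) auto
  ultimately show False using sum_cell_mult_le card_all_cells inc by linarith
qed

end

subsection \<open>Convex position\<close>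

lemma det3_on_line:
  assumes "det3 a b r = 0" "a \<noteq> b" "a \<noteq> r"
  obtains \<gamma> where "\<gamma> \<noteq> 0" "\<And>k. det3 a b k = \<gamma> * det3 r a k"
proof -
  have "det2 (a - r) (b - a) = 0"
    using assms(1) by (simp add: det3_alt det2_def algebra_simps)
  then have *: "b - a = (((b - a) \<bullet> (a - r)) / ((a - r) \<bullet> (a - r))) *\<^sub>R (a - r)" (is "_ = ?g *\<^sub>R _")
    using assms(3) by (intro det2_parallel) auto
  have "det3 a b k = ?g * det3 r a k" for k
  proof -
    have "det3 a b k = ?g * det2 (a - r) (k - a)"
      unfolding det3_def using * det2_scaleR(1) by metis
    also have "det2 (a - r) (k - a) = det3 r a k" by (simp add: det3_alt det2_def algebra_simps)
    finally show ?thesis .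
  qed
  moreover have "?g \<noteq> 0" using * assms(2) by (metis eq_iff_diff_eq_0 scaleR_zero_left)
  ultimately show thesis using that by blast
qed

section \<open>Tangents from the points of \<open>R\<close> to the hull of \<open>P\<close>\<close>

context blocked_set
begin

lemma exterior:
  assumes "r \<in> R" obtains u where "\<And>k. k \<in> P \<Longrightarrow> det2 u (k - r) > 0"
proof -
  obtain u where u: "\<forall>k\<in>P. det2 u (k - r) \<noteq> 0" "left_set P r u = {}"
    using all_exterior[OF assms] by (auto simp: cells_def)
  then have "det2 (- u) (k - r) > 0" if "k \<in> P" for k
    using that by (force simp: left_set_def)
  then show thesis using that by blast
qed

text \<open>An exterior point sees \<open>P\<close> within an open half-plane, where the cotangent
  sorts the directions.\<close>

lemma angular_key:
  assumes "r \<in> R"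
  obtains \<phi> :: "real ^ 2 \<Rightarrow> real" where
    "\<And>p k. p \<in> P \<Longrightarrow> k \<in> P \<Longrightarrow> det3 r p k > 0 \<longleftrightarrow> \<phi> k < \<phi> p"
    "\<And>p k. p \<in> P \<Longrightarrow> k \<in> P \<Longrightarrow> det3 r p k < 0 \<longleftrightarrow> \<phi> p < \<phi> k"
    "\<And>p k. p \<in> P \<Longrightarrow> k \<in> P \<Longrightarrow> det3 r p k = 0 \<longleftrightarrow> \<phi> p = \<phi> k"
proof -
  obtain u where u: "\<And>k. k \<in> P \<Longrightarrow> det2 u (k - r) > 0" using exterior[OF assms] by blast
  show thesis
    using that[of "\<lambda>k. cotan u (k - r)"] det2_pos_cotan[OF u u] unfolding det3_def by blast
qed

text \<open>The contact sets of the tangents from \<open>r\<close>; the sign \<open>s\<close>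
  records the side on which the rest of \<open>P\<close> lies.\<close>

definition tangent_classes :: "real ^ 2 \<Rightarrow> (real ^ 2) set set" where
  "tangent_classes r = {c \<in> lines P r. \<exists>s. \<forall>p\<in>c. \<forall>k\<in>P - c. s * det3 r p k > 0}"

lemma two_tangent_classes:
  assumes r: "r \<in> R" shows "card (tangent_classes r) \<ge> 2"
proof -
  obtain \<phi> :: "real ^ 2 \<Rightarrow> real" where \<phi>:
    "\<And>p k. p \<in> P \<Longrightarrow> k \<in> P \<Longrightarrow> det3 r p k > 0 \<longleftrightarrow> \<phi> k < \<phi> p"
    "\<And>p k. p \<in> P \<Longrightarrow> k \<in> P \<Longrightarrow> det3 r p k < 0 \<longleftrightarrow> \<phi> p < \<phi> k"
    "\<And>p k. p \<in> P \<Longrightarrow> k \<in> P \<Longrightarrow> det3 r p k = 0 \<longleftrightarrow> \<phi> p = \<phi> k"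
    using angular_key[OF r] by blast
  obtain a where a: "a \<in> P" "\<And>k. k \<in> P \<Longrightarrow> \<phi> a \<le> \<phi> k"
    using obtain_min[OF finP P_ne, of \<phi>] by blast
  obtain b where b: "b \<in> P" "\<And>k. k \<in> P \<Longrightarrow> \<phi> k \<le> \<phi> b"
    using obtain_max[OF finP P_ne, of \<phi>] by blast
  have line_class: "line_class P r x = {k \<in> P. \<phi> k = \<phi> x}" if "x \<in> P" for x
    using \<phi>(3)[OF that] by (auto simp: line_class_def)
  have "line_class P r a \<in> tangent_classes r"
  proof -
    have "- 1 * det3 r p k > 0" if "p \<in> line_class P r a" "k \<in> P - line_class P r a" for p k
      using that line_class[OF a(1)] a(2)[of k] \<phi>(2)[of p k] by fastforce
    then show ?thesis using a(1) unfolding tangent_classes_def lines_def by blast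
  qed
  moreover have "line_class P r b \<in> tangent_classes r"
  proof -
    have "1 * det3 r p k > 0" if "p \<in> line_class P r b" "k \<in> P - line_class P r b" for p k
      using that line_class[OF b(1)] b(2)[of k] \<phi>(1)[of p k] by fastforce
    then show ?thesis using b(1) unfolding tangent_classes_def lines_def by blast
  qed
  moreover have "line_class P r a \<noteq> line_class P r b"
  proof
    assume "line_class P r a = line_class P r b"
    then have "\<phi> a = \<phi> b" using a(1) b(1) line_class by blast
    then have "\<phi> k = \<phi> a" if "k \<in> P" for k using a(2)[OF that] b(2)[OF that] by linarith
    then have "line_class P r a = P" using line_class[OF a(1)] by auto
    moreover have "line_class P r a \<in> lines P r" using a(1) by (simp add: lines_def)
    ultimately show False using lines_card_cases[OF gp R_notin[OF r], of P] cardP n3 by simp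
  qed
  moreover have "finite (tangent_classes r)"
    using finite_lines[OF finP] by (simp add: tangent_classes_def)
  ultimately show ?thesis
    using card_mono[of "tangent_classes r" "{line_class P r a, line_class P r b}"] by simp
qed

definition hull_edges :: "(real ^ 2) set set" where
  "hull_edges = {e. \<exists>i\<in>P. \<exists>j\<in>P. i \<noteq> j \<and> e = {i, j} \<and> (\<forall>k\<in>P - e. det3 i j k > 0)}"

text \<open>Oriented with \<open>P\<close> on its left, a hull edge is determined by its first
  endpoint.\<close>

lemma card_hull_edges: "card hull_edges \<le> n"
proof -
  define tail where "tail e = (SOME i. \<exists>j\<in>P. i \<in> P \<and> i \<noteq> j \<and> e = {i, j} \<and> (\<forall>k\<in>P - e. det3 i j k > 0))" for e
  have tail: "\<exists>j\<in>P. tail e \<in> P \<and> tail e \<noteq> j \<and> e = {tail e, j} \<and> (\<forall>k\<in>P - e. det3 (tail e) j k > 0)"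
    if "e \<in> hull_edges" for e
  proof -
    have "\<exists>i. \<exists>j\<in>P. i \<in> P \<and> i \<noteq> j \<and> e = {i, j} \<and> (\<forall>k\<in>P - e. det3 i j k > 0)"
      using that unfolding hull_edges_def by blast
    from someI_ex[OF this] show ?thesis unfolding tail_def .
  qed
  have "inj_on tail hull_edges"
  proof (rule inj_onI)
    fix e e' assume e: "e \<in> hull_edges" "e' \<in> hull_edges" and eq: "tail e = tail e'"
    define t where "t = tail e"
    obtain j where j: "j \<in> P" "t \<noteq> j" "e = {t, j}" "\<forall>k\<in>P - e. det3 t j k > 0"
      using tail[OF e(1)] unfolding t_def by blast
    obtain j' where j': "j' \<in> P" "t \<noteq> j'" "e' = {t, j'}" "\<forall>k\<in>P - e'. det3 t j' k > 0"
      using tail[OF e(2)] unfolding t_def eq[symmetric] by blast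
    have False if "j \<noteq> j'"
    proof -
      have "det3 t j j' > 0" "det3 t j' j > 0" using j j' that by auto
      then show False using det3_swap[of t j' j] by simp
    qed
    then show "e = e'" using j(3) j'(3) by blast
  qed
  moreover have "tail ` hull_edges \<subseteq> P" using tail by blast
  ultimately show ?thesis using card_inj_on_le[of tail hull_edges P] finP cardP by simp
qed

lemma hull_edgeI:
  assumes "r \<in> R" "c \<in> tangent_classes r" "card c = 2"
  shows "c \<in> hull_edges"
proof -
  obtain i j where ij: "c = {i, j}" "i \<noteq> j" using assms(3) by (auto simp: card_2_iff)
  obtain s where s: "\<And>p k. p \<in> c \<Longrightarrow> k \<in> P - c \<Longrightarrow> s * det3 r p k > 0"
    using assms(2) unfolding tangent_classes_def by blast
  have c: "c \<in> lines P r" using assms(2) by (simp add: tangent_classes_def)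
  have P: "i \<in> P" "j \<in> P" using c ij by (auto simp: lines_def line_class_def)
  have "line_class P r i = c"
    using lines_disjoint[OF R_notin[OF assms(1)], of "line_class P r i" c i] c P(1) ij line_class_self[OF P(1)]
    by (auto simp: lines_def)
  then have "det3 r i j = 0" using ij by (auto simp: line_class_def)
  then have 0: "det3 i j r = 0" by (rule det3_eq_0_perm)
  obtain \<gamma> where \<gamma>: "\<gamma> \<noteq> 0" "\<And>k. det3 i j k = \<gamma> * det3 r i k"
    using det3_on_line[OF 0 ij(2)] R_notin[OF assms(1)] P(1) by metis
  have pos: "(s * \<gamma>) * det3 i j k > 0" if "k \<in> P - c" for k
  proof -
    have "(s * \<gamma>) * det3 i j k = (\<gamma> * \<gamma>) * (s * det3 r i k)" by (simp add: \<gamma>(2))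
    moreover have "\<gamma> * \<gamma> > 0" using \<gamma>(1) by (metis not_real_square_gt_zero)
    ultimately show ?thesis using s[of i k] that ij(1) by (metis insertI1 mult_pos_pos)
  qed
  have sw: "det3 j i k = - det3 i j k" for k by (simp add: det3_alt algebra_simps)
  have "(\<forall>k\<in>P - c. det3 i j k > 0) \<or> (\<forall>k\<in>P - c. det3 j i k > 0)"
  proof (cases "s * \<gamma> > 0")
    case True
    then show ?thesis using zero_less_mult_pos[OF pos] by blast
  next
    case False
    have "det3 i j k < 0" if "k \<in> P - c" for k
      using pos[OF that] False mult_nonpos_nonneg[of "s * \<gamma>" "det3 i j k"] by linarith
    then show ?thesis unfolding sw by simp
  qed
  then show ?thesis
  proof
    assume "\<forall>k\<in>P - c. det3 i j k > 0"
    then show ?thesis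
      unfolding hull_edges_def mem_Collect_eq by (intro bexI[OF _ P(1)] bexI[OF _ P(2)] conjI ij)
  next
    assume "\<forall>k\<in>P - c. det3 j i k > 0"
    moreover have "c = {j, i}" using ij(1) by (simp add: insert_commute)
    ultimately show ?thesis
      unfolding hull_edges_def mem_Collect_eq by (intro bexI[OF _ P(2)] bexI[OF _ P(1)] conjI ij(2)[symmetric])
  qed
qed

text \<open>The \<open>n - 1\<close> lines from \<open>i\<close> to the other points of
  \<open>P\<close> have distinct blocking points, so at most one of the \<open>n\<close> points of
  \<open>R\<close> sees \<open>i\<close> alone on its line.\<close>

lemma unmatched_unique:
  assumes i: "i \<in> P" and r: "r \<in> R" "line_class P r i = {i}" and s: "s \<in> R" "line_class P s i = {i}"
  shows "r = s"
proof (rule ccontr)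
  assume "r \<noteq> s"
  define b where "b j = (SOME t. t \<in> R \<and> det3 i j t = 0)" for j
  have b: "b j \<in> R" "det3 i j (b j) = 0" if "j \<in> P - {i}" for j
  proof -
    have "\<exists>t. t \<in> R \<and> det3 i j t = 0" using blocked[OF i, of j] that by blast
    then have "b j \<in> R \<and> det3 i j (b j) = 0" unfolding b_def by (rule someI_ex)
    then show "b j \<in> R" "det3 i j (b j) = 0" by auto
  qed
  have line_class: "line_class P (b j) i = {i, j}" if "j \<in> P - {i}" for j
    using line_class_pair[OF gp R_notin[OF b(1)[OF that]] i _ _ b(2)[OF that]] that by auto
  have "inj_on b (P - {i})"
    by (rule inj_onI) (use line_class in \<open>metis DiffD2 doubleton_eq_iff insertI1\<close>)
  moreover have "b ` (P - {i}) \<subseteq> R - {r, s}"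
  proof
    fix t assume "t \<in> b ` (P - {i})"
    then obtain j where j: "j \<in> P - {i}" "t = b j" by blast
    then have "line_class P t i \<noteq> {i}" using line_class[OF j(1)] by auto
    then show "t \<in> R - {r, s}" using b(1)[OF j(1)] j(2) r(2) s(2) by auto
  qed
  ultimately have "card (P - {i}) \<le> card (R - {r, s})"
    using card_inj_on_le finR by blast
  then show False using i r(1) s(1) \<open>r \<noteq> s\<close> finR finP cardP cardR n3 by (simp add: card_Diff_subset)
qed

text \<open>There are at least \<open>2 * n\<close> tangents. Those touching \<open>P\<close> in a
  pair give distinct hull edges, hence are at most \<open>n\<close>; those touching it in one point
  have distinct contact points by \<open>unmatched_unique\<close>. So there are at least
  \<open>n\<close> of the latter and every \<open>i\<close> occurs.\<close>

lemma tangent_single: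
  assumes "i \<in> P" shows "\<exists>r\<in>R. {i} \<in> tangent_classes r"
proof -
  define T1 where "T1 r = {c \<in> tangent_classes r. card c = 1}" for r
  define T2 where "T2 r = {c \<in> tangent_classes r. card c = 2}" for r
  have fin: "finite (tangent_classes r)" for r
    using finite_lines[OF finP] by (simp add: tangent_classes_def)
  have "2 * n = (\<Sum>r\<in>R. 2)" using cardR by simp
  also have "\<dots> \<le> (\<Sum>r\<in>R. card (T1 r) + card (T2 r))"
  proof (intro sum_mono)
    fix r assume r: "r \<in> R"
    have "tangent_classes r = T1 r \<union> T2 r"
      using lines_card_cases[OF gp R_notin[OF r]] by (auto simp: T1_def T2_def tangent_classes_def)
    then have "card (tangent_classes r) \<le> card (T1 r) + card (T2 r)"
      using card_Un_le[of "T1 r" "T2 r"] by simp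
    then show "2 \<le> card (T1 r) + card (T2 r)" using two_tangent_classes[OF r] by simp
  qed
  also have "\<dots> = card (Sigma R T1) + card (Sigma R T2)"
    using finR fin by (simp add: sum.distrib T1_def T2_def)
  finally have 1: "2 * n \<le> card (Sigma R T1) + card (Sigma R T2)" .
  have "card (Sigma R T2) \<le> card hull_edges"
  proof (rule card_inj_on_le[of snd])
    show "inj_on snd (Sigma R T2)"
      using unique_blocker by (auto simp: inj_on_def T2_def secants_def tangent_classes_def)
    show "snd ` Sigma R T2 \<subseteq> hull_edges" using hull_edgeI by (auto simp: T2_def)
    show "finite hull_edges"
      by (rule finite_subset[of _ "Pow P"]) (auto simp: hull_edges_def finP)
  qed
  then have 2: "card (Sigma R T2) \<le> n" using card_hull_edges by simp
  define g where "g x = (THE i. snd x = {i :: real ^ 2})" for x :: "(real ^ 2) \<times> (real ^ 2) set"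
  have g: "g x \<in> P" "snd x = {g x}" "fst x \<in> R" "{g x} \<in> tangent_classes (fst x)"
    "line_class P (fst x) (g x) = {g x}" if x1: "x \<in> Sigma R T1" for x
  proof -
    obtain r c where "x = (r, c)" "r \<in> R" "c \<in> T1 r" using x1 by blast
    then have x: "x = (r, c)" "r \<in> R" "c \<in> tangent_classes r" "card c = 1"
      by (simp_all add: T1_def)
    then obtain i where i: "c = {i}" by (auto simp: card_1_singleton_iff)
    obtain p where p: "p \<in> P" "c = line_class P r p" using x(3) by (auto simp: tangent_classes_def lines_def)
    then have "p = i" using line_class_self[OF p(1), of r] i by auto
    moreover have "g x = i" using x i by (simp add: g_def)
    ultimately show "g x \<in> P" "snd x = {g x}" "fst x \<in> R" "{g x} \<in> tangent_classes (fst x)"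
      "line_class P (fst x) (g x) = {g x}"
      using x i p by simp_all
  qed
  have inj: "inj_on g (Sigma R T1)"
  proof (rule inj_onI)
    fix x y assume x: "x \<in> Sigma R T1" and y: "y \<in> Sigma R T1" and eq: "g x = g y"
    have "fst x = fst y"
      using unmatched_unique[OF g(1)[OF x] g(3)[OF x] g(5)[OF x] g(3)[OF y]] g(5)[OF y] eq by simp
    then show "x = y" using g(2)[OF x] g(2)[OF y] eq by (simp add: prod_eq_iff)
  qed
  have sub: "g ` Sigma R T1 \<subseteq> P" using g(1) by (rule image_subsetI)
  have "card (Sigma R T1) \<ge> card P" using 1 2 cardP by simp
  then have "card P \<le> card (g ` Sigma R T1)" using card_image[OF inj] by simp
  then have "g ` Sigma R T1 = P" using card_seteq[OF finP sub] by blast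
  then obtain x where "x \<in> Sigma R T1" "g x = i" using assms by blast
  then show ?thesis using g(3,4)[of x] by auto
qed

text \<open>\<open>tangent_single\<close> provides a point of \<open>R\<close> with a tangent
  touching \<open>P\<close> only at \<open>i\<close>, and by \<open>unmatched_unique\<close> this
  point is \<open>r\<close>.\<close>

lemma unmatched_extreme:
  assumes "r \<in> R" "i \<in> P" "line_class P r i = {i}"
  obtains s where "\<And>k. k \<in> P - {i} \<Longrightarrow> s * det3 r i k > 0"
proof -
  obtain r' where r': "r' \<in> R" "{i} \<in> tangent_classes r'" using tangent_single[OF assms(2)] by blast
  then obtain p where "p \<in> P" "{i} = line_class P r' p" by (auto simp: tangent_classes_def lines_def)
  then have "line_class P r' i = {i}" using line_class_self by (metis singletonD)
  then have "r' = r" using unmatched_unique assms r'(1) by blast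
  then show thesis using that r'(2) unfolding tangent_classes_def by blast
qed

lemma hull_vertex:
  assumes "i \<in> P" obtains u where "\<And>k. k \<in> P - {i} \<Longrightarrow> det2 u (k - i) > 0"
proof -
  obtain r s where s: "\<And>k. k \<in> P - {i} \<Longrightarrow> s * det3 r i k > 0"
    using tangent_single[OF assms] unfolding tangent_classes_def by blast
  have eq: "det2 (s *\<^sub>R (i - r)) (k - i) = s * det3 r i k" for k
    by (simp add: det3_alt det2_def algebra_simps)
  show thesis by (rule that[of "s *\<^sub>R (i - r)"]) (simp only: eq s)
qed

text \<open>Rotating the line \<open>ab\<close> about \<open>r\<close>, the next points of \<open>P\<close> it meets come as a pair again.\<close>
lemma next_pair:
  assumes r: "r \<in> R" and ab: "a \<in> P" "b \<in> P" "a \<noteq> b" "det3 a b r = 0"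
    and S: "S = {k \<in> P. \<sigma> * det3 a b k > 0}" "card S \<ge> 2"
  obtains c d \<tau> where "c \<in> S" "d \<in> S" "c \<noteq> d" "det3 c d r = 0"
    "\<And>k. k \<in> S - {c, d} \<Longrightarrow> \<tau> * det3 c d k > 0" "\<tau> * det3 c d a < 0"
proof -
  obtain \<phi> :: "real ^ 2 \<Rightarrow> real" where \<phi>:
    "\<And>p k. p \<in> P \<Longrightarrow> k \<in> P \<Longrightarrow> det3 r p k > 0 \<longleftrightarrow> \<phi> k < \<phi> p"
    "\<And>p k. p \<in> P \<Longrightarrow> k \<in> P \<Longrightarrow> det3 r p k < 0 \<longleftrightarrow> \<phi> p < \<phi> k"
    "\<And>p k. p \<in> P \<Longrightarrow> k \<in> P \<Longrightarrow> det3 r p k = 0 \<longleftrightarrow> \<phi> p = \<phi> k"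
    using angular_key[OF r] by blast
  have nr: "r \<notin> P" using R_notin[OF r] .
  obtain \<gamma> where \<gamma>: "\<gamma> \<noteq> 0" "\<And>k. det3 a b k = \<gamma> * det3 r a k"
    using det3_on_line[OF ab(4,3)] nr ab(1) by metis
  \<comment> \<open>This sign orients the angular key so that \<open>S\<close> consists of the
    points of \<open>P\<close> with larger key than \<open>a\<close>.\<close>
  define \<epsilon> :: real where "\<epsilon> = (if \<sigma> * \<gamma> > 0 then - 1 else 1)"
  have \<epsilon>: "\<epsilon> = 1 \<or> \<epsilon> = - 1" by (simp add: \<epsilon>_def)
  define \<psi> where "\<psi> k = \<epsilon> * \<phi> k" for k
  have \<psi>: "\<epsilon> * det3 r p k > 0 \<longleftrightarrow> \<psi> k < \<psi> p" "\<epsilon> * det3 r p k < 0 \<longleftrightarrow> \<psi> p < \<psi> k"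
    "det3 r p k = 0 \<longleftrightarrow> \<psi> p = \<psi> k" if "p \<in> P" "k \<in> P" for p k
    using \<epsilon> \<phi>[OF that] by (auto simp: \<psi>_def)
  have above: "\<psi> a < \<psi> k" if "k \<in> S" for k
  proof -
    have "\<sigma> * \<gamma> * det3 r a k > 0" using that by (simp add: S(1) \<gamma>(2) mult.assoc)
    then have "\<epsilon> * det3 r a k < 0"
      unfolding \<epsilon>_def by (cases "\<sigma> * \<gamma> > 0") (auto simp: zero_less_mult_iff)
    then show ?thesis using \<psi>(2)[OF ab(1)] that by (simp add: S(1))
  qed
  have above': "k \<in> S" if "k \<in> P" "\<psi> a < \<psi> k" "S \<noteq> {}" for k
  proof -
    have "\<sigma> * \<gamma> \<noteq> 0" using \<open>S \<noteq> {}\<close> \<gamma>(1) by (auto simp: S(1))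
    have "\<epsilon> * det3 r a k < 0" using \<psi>(2)[OF ab(1) that(1)] that(2) by simp
    then have "\<sigma> * \<gamma> * det3 r a k > 0"
      using \<open>\<sigma> * \<gamma> \<noteq> 0\<close> unfolding \<epsilon>_def
      by (cases "\<sigma> * \<gamma> > 0") (auto simp: zero_less_mult_iff mult_less_0_iff not_less)
    then show ?thesis using that(1) by (simp add: S(1) \<gamma>(2) mult.assoc)
  qed
  have finS: "finite S" using finP by (simp add: S(1))
  have neS: "S \<noteq> {}" using S(2) by auto
  obtain c where c: "c \<in> S" "\<And>k. k \<in> S \<Longrightarrow> \<psi> c \<le> \<psi> k"
    using obtain_min[OF finS neS, of \<psi>] by blast
  have cP: "c \<in> P" using c(1) by (simp add: S(1))
  \<comment> \<open>If \<open>c\<close> were alone on its line, the rest of \<open>P\<close> would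
    lie on one side of that line, but \<open>a\<close> comes before \<open>c\<close> and another
    point of \<open>S\<close> does not.\<close>
  have "line_class P r c \<noteq> {c}"
  proof
    assume "line_class P r c = {c}"
    then obtain s where s: "\<And>k. k \<in> P - {c} \<Longrightarrow> s * det3 r c k > 0"
      using unmatched_extreme[OF r cP] by blast
    have "S - {c} \<noteq> {}"
    proof
      assume "S - {c} = {}"
      then have "card S \<le> card {c}" by (intro card_mono) auto
      then show False using S(2) by simp
    qed
    then obtain k where k: "k \<in> S" "k \<noteq> c" by blast
    then have kP: "k \<in> P" by (simp add: S(1))
    have "s * det3 r c a > 0" "s * det3 r c k > 0"
      using s ab(1) kP k(2) above[OF c(1)] by auto
    moreover have "\<epsilon> * det3 r c a > 0" using \<psi>(1)[OF cP ab(1)] above[OF c(1)] by simp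
    moreover have "\<epsilon> * det3 r c k \<le> 0" using \<psi>(1)[OF cP kP] c(2)[OF k(1)] by linarith
    ultimately show False using \<epsilon> by (auto simp: zero_less_mult_iff)
  qed
  then obtain d where d: "d \<in> P" "d \<noteq> c" "det3 r c d = 0"
    using line_class_self[OF cP] unfolding line_class_def by blast
  have "\<psi> d = \<psi> c" using \<psi>(3)[OF cP d(1)] d(3) by simp
  then have dS: "d \<in> S" using above'[OF d(1) _ neS] above[OF c(1)] by simp
  have cd: "det3 c d r = 0" using det3_eq_0_perm(3)[OF d(3)] .
  obtain \<delta> where \<delta>: "\<delta> \<noteq> 0" "\<And>k. det3 c d k = \<delta> * det3 r c k"
    using det3_on_line[OF cd d(2)[symmetric]] nr cP by metis
  have dd: "\<delta> * \<delta> > 0" using \<delta>(1) by (metis not_real_square_gt_zero)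
  have eq: "(- \<epsilon> * \<delta>) * det3 c d k = (\<delta> * \<delta>) * - (\<epsilon> * det3 r c k)" for k by (simp add: \<delta>(2))
  show thesis
  proof (rule that[of c d "- \<epsilon> * \<delta>"])
    show "c \<in> S" "d \<in> S" "c \<noteq> d" "det3 c d r = 0" using c(1) dS d(2) cd by auto
    show "(- \<epsilon> * \<delta>) * det3 c d k > 0" if k: "k \<in> S - {c, d}" for k
    proof -
      have kP: "k \<in> P" using k by (simp add: S(1))
      have "k \<notin> line_class P r c"
        using k line_class_pair[OF gp nr cP d(1) d(2)[symmetric] cd] by blast
      then have "\<psi> c \<noteq> \<psi> k" using \<psi>(3)[OF cP kP] kP by (simp add: line_class_def)
      then have "\<psi> c < \<psi> k" using c(2)[of k] k by simp
      then have "- (\<epsilon> * det3 r c k) > 0" using \<psi>(2)[OF cP kP] by simp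
      then show ?thesis unfolding eq using dd by (rule mult_pos_pos[rotated])
    qed
    have "- (\<epsilon> * det3 r c a) < 0" using \<psi>(1)[OF cP ab(1)] above[OF c(1)] by simp
    then show "(- \<epsilon> * \<delta>) * det3 c d a < 0" unfolding eq using dd by (metis mult_pos_neg)
  qed
qed

text \<open>The points are sorted by angle about one vertex \<open>p0\<close>, which settles the
  triples containing it. The other triples follow because the middle point is a hull vertex
  too.\<close>

lemma convex_enumeration:
  obtains p :: "nat \<Rightarrow> real ^ 2" where "bij_betw p {..<n} P"
    "\<And>i j k. i < j \<Longrightarrow> j < k \<Longrightarrow> k < n \<Longrightarrow> det3 (p i) (p j) (p k) > 0"
proof -
  obtain p0 where p0: "p0 \<in> P" using P_ne by blast
  obtain u where u: "\<And>k. k \<in> P - {p0} \<Longrightarrow> det2 u (k - p0) > 0" using hull_vertex[OF p0] by blast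
  define \<kappa> where "\<kappa> k = - cotan u (k - p0)" for k
  have d3: "det3 p0 a k > 0 \<longleftrightarrow> \<kappa> a < \<kappa> k" "det3 p0 a k = 0 \<longleftrightarrow> \<kappa> a = \<kappa> k"
    if "a \<in> P - {p0}" "k \<in> P - {p0}" for a k
    using det2_pos_cotan[OF u[OF that(1)] u[OF that(2)]] unfolding det3_def \<kappa>_def by auto
  have inj: "inj_on \<kappa> (P - {p0})"
    using d3(2) gp3D[OF gp p0] by (intro inj_onI) (metis DiffE insertI1)
  define xs where "xs = sorted_list_of_set (\<kappa> ` (P - {p0}))"
  have fin: "finite (\<kappa> ` (P - {p0}))" using finP by simp
  have xs: "set xs = \<kappa> ` (P - {p0})" "sorted_wrt (<) xs" "distinct xs"
    using fin by (simp_all add: xs_def)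
  have len: "length xs = n - 1"
    using card_image[OF inj] p0 cardP finP distinct_card[OF xs(3)] xs(1) by simp
  define p where "p i = (case i of 0 \<Rightarrow> p0 | Suc i \<Rightarrow> inv_into (P - {p0}) \<kappa> (xs ! i))" for i
  have pS: "p (Suc i) \<in> P - {p0}" "\<kappa> (p (Suc i)) = xs ! i" if "Suc i < n" for i
  proof -
    have "xs ! i \<in> \<kappa> ` (P - {p0})" using xs(1) len that by (metis less_diff_conv nth_mem Suc_eq_plus1)
    then show "p (Suc i) \<in> P - {p0}" "\<kappa> (p (Suc i)) = xs ! i"
      unfolding p_def by (simp_all add: inv_into_into f_inv_into_f del: Diff_iff)
  qed
  have p0': "p 0 = p0" by (simp add: p_def)
  have \<kappa>less: "\<kappa> (p i) < \<kappa> (p j)" if lt: "0 < i" "i < j" "j < n" for i j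
  proof -
    obtain i' j' where "i = Suc i'" "j = Suc j'" using lt by (cases i; cases j) auto
    then show ?thesis using lt pS sorted_wrt_nth_less[OF xs(2), of i' j'] len by simp
  qed
  have memP: "p i \<in> P - {p0}" if "0 < i" "i < n" for i
    using that pS by (cases i) auto
  have injp: "inj_on p {..<n}"
  proof (rule linorder_inj_onI)
    fix i j :: nat assume ij: "i < j" "i \<in> {..<n}" "j \<in> {..<n}"
    show "p i \<noteq> p j"
    proof (cases "i = 0")
      case True
      then show ?thesis using memP[of j] ij p0' by auto
    next
      case False
      then show ?thesis using \<kappa>less[of i j] ij by auto
    qed
  qed auto
  have img: "p ` {..<n} \<subseteq> P"
  proof (intro image_subsetI)
    fix i assume "i \<in> {..<n}"
    then show "p i \<in> P" using memP[of i] p0 p0' by (cases "i = 0") auto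
  qed
  have "p ` {..<n} = P"
    using card_subset_eq[OF finP img] card_image[OF injp] cardP by simp
  then have bij: "bij_betw p {..<n} P" using injp by (simp add: bij_betw_def)
  have z: "det3 (p 0) (p j) (p k) > 0" if "0 < j" "j < k" "k < n" for j k
    using d3(1)[OF memP memP, of j k] \<kappa>less[OF that] that p0' by auto
  have "det3 (p i) (p j) (p k) > 0" if ijk: "i < j" "j < k" "k < n" for i j k
  proof (cases "i = 0")
    case True
    then show ?thesis using z ijk by simp
  next
    case False
    have P: "p i \<in> P" "p j \<in> P" "p k \<in> P" using ijk img by auto
    have ne: "p i \<noteq> p j" "p i \<noteq> p k" "p j \<noteq> p k" "p 0 \<noteq> p j"
      using inj_onD[OF injp] ijk by (metis lessThan_iff less_trans not_less_iff_gr_or_eq zero_less_iff_neq_zero order_less_trans)+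
    obtain v where v: "\<And>x. x \<in> P - {p j} \<Longrightarrow> det2 v (x - p j) > 0" using hull_vertex[OF P(2)] by blast
    define f where "f x = det2 v (x - p j)" for x
    \<comment> \<open>A three-term Pluecker relation for the vectors from \<open>p j\<close>. The
      values of \<open>f\<close> are positive because \<open>v\<close> directs a supporting line at
      \<open>p j\<close>.\<close>
    have id: "f (p 0) * det3 (p i) (p j) (p k) = f (p i) * det3 (p 0) (p j) (p k) + f (p k) * det3 (p 0) (p i) (p j)"
      unfolding f_def det3_alt det2_def by (simp add: algebra_simps)
    have "f (p 0) > 0" "f (p i) > 0" "f (p k) > 0"
      unfolding f_def using v P ne p0 p0' by auto
    moreover have "det3 (p 0) (p j) (p k) > 0" "det3 (p 0) (p i) (p j) > 0"
      using z ijk False by auto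
    ultimately have "f (p 0) * det3 (p i) (p j) (p k) > 0"
      unfolding id by (intro add_pos_pos mult_pos_pos)
    then show ?thesis using \<open>f (p 0) > 0\<close> by (simp add: zero_less_mult_iff)
  qed
  then show thesis using that bij by blast
qed

end

subsection \<open>Cyclic structure\<close>

context blocked_set
begin

context
  fixes p :: "nat \<Rightarrow> real ^ 2"
  assumes bij: "bij_betw p {..<n} P"
    and ccw: "\<And>i j k. i < j \<Longrightarrow> j < k \<Longrightarrow> k < n \<Longrightarrow> det3 (p i) (p j) (p k) > 0"
begin

lemma p_in: "i < n \<Longrightarrow> p i \<in> P"
  using bij by (auto simp: bij_betw_def)

lemma p_eq: "i < n \<Longrightarrow> j < n \<Longrightarrow> p i = p j \<longleftrightarrow> i = j"
  using bij unfolding bij_betw_def inj_on_def by blast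

lemma p_surj: "x \<in> P \<Longrightarrow> \<exists>i<n. x = p i"
  using bij by (auto simp: bij_betw_def)

lemma p_image_interval:
  assumes "\<And>k. k < n \<Longrightarrow> Q (p k) \<longleftrightarrow> lo < k \<and> k < hi" "hi \<le> n"
  shows "{x \<in> P. Q x} = p ` {lo<..<hi}"
proof (intro equalityI subsetI)
  fix x assume "x \<in> {x \<in> P. Q x}"
  then obtain k where "k < n" "x = p k" "Q (p k)" using p_surj by blast
  then show "x \<in> p ` {lo<..<hi}" using assms(1) by simp
next
  fix x assume "x \<in> p ` {lo<..<hi}"
  then obtain k where "x = p k" "lo < k" "k < hi" by auto
  then show "x \<in> {x \<in> P. Q x}" using assms p_in[of k] by simp
qed

text \<open>For the pair \<open>p k\<close>, \<open>p l\<close> of \<open>next_pair\<close> with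
  \<open>k < l\<close>, the point \<open>p i\<close> precedes both. So the rest of the interval lies
  on the other side of the chord, that is between \<open>k\<close> and \<open>l\<close>, and these
  are the ends of the interval.\<close>

lemma next_interval_pair:
  assumes r: "r \<in> R" and ij: "i < n" "j < n" "i \<noteq> j" "det3 (p i) (p j) r = 0"
    and S: "{k \<in> P. \<sigma> * det3 (p i) (p j) k > 0} = p ` {lo<..<hi}" and lo: "i \<le> lo" "lo + 3 \<le> hi" "hi \<le> n"
  shows "det3 (p (lo + 1)) (p (hi - 1)) r = 0"
proof -
  have inj: "inj_on p {lo<..<hi}"
    using inj_on_subset[OF bij_betw_imp_inj_on[OF bij], of "{lo<..<hi}"] lo(3) by fastforce
  have card: "card (p ` {lo<..<hi}) \<ge> 2" using card_image[OF inj] lo by simp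
  have ne: "p i \<noteq> p j" using p_eq ij by simp
  obtain c d \<tau> where cd: "c \<in> p ` {lo<..<hi}" "d \<in> p ` {lo<..<hi}" "c \<noteq> d" "det3 c d r = 0"
    and \<tau>: "\<And>k. k \<in> p ` {lo<..<hi} - {c, d} \<Longrightarrow> \<tau> * det3 c d k > 0" "\<tau> * det3 c d (p i) < 0"
    using next_pair[OF r p_in[OF ij(1)] p_in[OF ij(2)] ne ij(4) S[symmetric] card] by blast
  have main: "det3 (p (lo + 1)) (p (hi - 1)) r = 0"
    if k: "lo < k" "k < l" "l < hi" and 0: "det3 (p k) (p l) r = 0"
      and m: "\<And>m. lo < m \<Longrightarrow> m < hi \<Longrightarrow> m \<noteq> k \<Longrightarrow> m \<noteq> l \<Longrightarrow> \<tau>' * det3 (p k) (p l) (p m) > 0"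
      and i: "\<tau>' * det3 (p k) (p l) (p i) < 0" for k l \<tau>'
  proof -
    have "det3 (p k) (p l) (p i) > 0"
      using ccw[of i k l] k lo det3_rotate[of "p i"] by simp
    then have neg: "\<tau>' < 0" using i by (simp add: mult_less_0_iff)
    have between: "k < m \<and> m < l" if mm: "lo < m" "m < hi" "m \<noteq> k" "m \<noteq> l" for m
    proof (rule ccontr)
      assume "\<not> (k < m \<and> m < l)"
      then consider "m < k" | "l < m" using mm by linarith
      then have "det3 (p k) (p l) (p m) > 0"
      proof cases
        case 1
        then show ?thesis using ccw[of m k l] k lo det3_rotate[of "p m"] by simp
      next
        case 2
        then show ?thesis using ccw[of k l m] k lo mm by simp
      qed
      then show False using m[OF mm] neg by (simp add: zero_less_mult_iff)
    qed
    have "k = lo + 1"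
      using between[of "lo + 1"] k lo by fastforce
    moreover have "l = hi - 1"
      using between[of "hi - 1"] k lo by fastforce
    ultimately show ?thesis using 0 by simp
  qed
  obtain k l where kl: "c = p k" "d = p l" "lo < k" "k < hi" "lo < l" "l < hi"
    using cd(1,2) by auto
  have memm: "p m \<in> p ` {lo<..<hi} - {c, d}" if "lo < m" "m < hi" "m \<noteq> k" "m \<noteq> l" for m
    using that kl lo p_eq[of m k] p_eq[of m l] by auto
  have "k \<noteq> l" using cd(3) kl by auto
  then consider "k < l" | "l < k" by linarith
  then show ?thesis
  proof cases
    case 1
    show ?thesis
      by (rule main[of k l \<tau>]) (use 1 kl cd(4) \<tau> memm in auto)
  next
    case 2
    have sw: "det3 (p l) (p k) x = - det3 (p k) (p l) x" for x
      by (simp add: det3_alt algebra_simps)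
    show ?thesis
      by (rule main[of l k "- \<tau>"]) (use 2 kl cd(4) \<tau> memm in \<open>auto simp: sw\<close>)
  qed
qed

lemma shrink_pair:
  assumes "r \<in> R" "i + 3 \<le> j" "j < n" "det3 (p i) (p j) r = 0"
  shows "det3 (p (i + 1)) (p (j - 1)) r = 0"
proof (rule next_interval_pair[where \<sigma> = "- 1"])
  have sign: "det3 (p i) (p j) (p k) < 0 \<longleftrightarrow> i < k \<and> k < j" if "k < n" for k
  proof -
    consider "k < i" | "k = i" | "i < k" "k < j" | "k = j" | "j < k" by linarith
    then show ?thesis
    proof cases
      case 1
      then show ?thesis using ccw[of k i j] assms det3_rotate[of "p k"] by simp
    next
      case 3
      then show ?thesis using ccw[of i k j] assms det3_swap[of "p i" "p j" "p k"] by simp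
    next
      case 5
      then show ?thesis using ccw[of i j k] assms that by simp
    qed simp_all
  qed
  show "{k \<in> P. - 1 * det3 (p i) (p j) k > 0} = p ` {i<..<j}"
    by (rule p_image_interval) (use sign assms(3) in simp_all)
qed (use assms in auto)

text \<open>Turning to the other side of the chord from \<open>p 0\<close> to \<open>p j\<close>:
  the new indices \<open>j + 1\<close> and \<open>n - 1\<close> have sum \<open>n + j\<close>, so
  index sums start to wrap around modulo \<open>n\<close>.\<close>

lemma wrap_pair:
  assumes "r \<in> R" "1 \<le> j" "j + 3 \<le> n" "det3 (p 0) (p j) r = 0"
  shows "det3 (p (j + 1)) (p (n - 1)) r = 0"
proof (rule next_interval_pair[where \<sigma> = 1])
  have sign: "det3 (p 0) (p j) (p k) > 0 \<longleftrightarrow> j < k" if "k < n" for k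
  proof -
    consider "k = 0" | "0 < k" "k < j" | "k = j" | "j < k" by linarith
    then show ?thesis
    proof cases
      case 2
      then show ?thesis using ccw[of 0 k j] assms det3_swap[of "p 0" "p j" "p k"] by simp
    next
      case 4
      then show ?thesis using ccw[of 0 j k] assms that by simp
    qed simp_all
  qed
  show "{k \<in> P. 1 * det3 (p 0) (p j) k > 0} = p ` {j<..<n}"
    by (rule p_image_interval) (use sign in simp_all)
qed (use assms in auto)

definition blocker :: "nat \<Rightarrow> nat \<Rightarrow> real ^ 2" where
  "blocker i j = (SOME r. r \<in> R \<and> det3 (p i) (p j) r = 0)"

lemma blocker:
  assumes "i < j" "j < n" shows "blocker i j \<in> R" "det3 (p i) (p j) (blocker i j) = 0"
proof -
  have "\<exists>r. r \<in> R \<and> det3 (p i) (p j) r = 0"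
    using blocked[OF p_in p_in, of i j] p_eq assms by force
  from someI_ex[OF this] show "blocker i j \<in> R" "det3 (p i) (p j) (blocker i j) = 0"
    unfolding blocker_def by auto
qed

lemma blocker_eqI:
  assumes "i < j" "j < n" "r \<in> R" "det3 (p i) (p j) r = 0" shows "blocker i j = r"
proof -
  have ne: "p i \<noteq> p j" using p_eq assms by simp
  have P: "p i \<in> P" "p j \<in> P" using p_in assms by auto
  show ?thesis
    using unique_blocker[OF blocker(1)[OF assms(1,2)] assms(3)
        pair_in_secants[OF gp R_notin[OF blocker(1)[OF assms(1,2)]] P ne blocker(2)[OF assms(1,2)]]
        pair_in_secants[OF gp R_notin[OF assms(3)] P ne assms(4)]] .
qed

text \<open>The innermost pair of index sum \<open>s\<close>: the indices differ by one for odd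
  \<open>s\<close> and by two for even \<open>s\<close>.\<close>

definition blocker_sum :: "nat \<Rightarrow> real ^ 2" where
  "blocker_sum s = blocker ((s - 1) div 2) (s - (s - 1) div 2)"

lemma blocker_eq_sum: "i < j \<Longrightarrow> j < n \<Longrightarrow> blocker i j = blocker_sum (i + j)"
proof (induction "j - i" arbitrary: i j rule: less_induct)
  case less
  show ?case
  proof (cases "i + 3 \<le> j")
    case True
    have "blocker (i + 1) (j - 1) = blocker i j"
      by (rule blocker_eqI) (use True less.prems shrink_pair blocker in auto)
    moreover have "blocker (i + 1) (j - 1) = blocker_sum (i + 1 + (j - 1))"
      by (rule less.hyps) (use True less.prems in auto)
    ultimately show ?thesis using True by simp
  next
    case False
    then consider "j = i + 1" | "j = i + 2" using less.prems by linarith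
    then show ?thesis by cases (auto simp: blocker_sum_def)
  qed
qed

lemma blocker_sum_wrap:
  assumes "1 \<le> j" "j + 3 \<le> n" shows "blocker_sum (n + j) = blocker_sum j"
proof -
  have "blocker (j + 1) (n - 1) = blocker 0 j"
    by (rule blocker_eqI) (use assms wrap_pair blocker[of 0 j] in auto)
  moreover have "blocker (j + 1) (n - 1) = blocker_sum (j + 1 + (n - 1))"
    by (rule blocker_eq_sum) (use assms in auto)
  moreover have "blocker 0 j = blocker_sum (0 + j)"
    by (rule blocker_eq_sum) (use assms in auto)
  moreover have "j + 1 + (n - 1) = n + j" using n3 by simp
  ultimately show ?thesis by (simp only: add_0_left)
qed

text \<open>The residue zero is represented by \<open>n\<close>, because no two distinct indices
  have sum zero.\<close>

definition blocker_mod :: "nat \<Rightarrow> real ^ 2" where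
  "blocker_mod s = blocker_sum (if s mod n = 0 then n else s mod n)"

lemma blocker_eq_mod:
  assumes "i < j" "j < n" shows "blocker i j = blocker_mod (i + j)"
proof -
  have eq: "blocker i j = blocker_sum (i + j)" by (rule blocker_eq_sum[OF assms])
  consider "i + j < n" | "i + j = n" | "n < i + j" by linarith
  then show ?thesis
  proof cases
    case 3
    define m where "m = i + j - n"
    have m: "i + j = n + m" "1 \<le> m" "m + 3 \<le> n" using 3 assms by (auto simp: m_def)
    then have "(i + j) mod n = m" by simp
    then show ?thesis using eq m blocker_sum_wrap[OF m(2,3)] by (simp add: blocker_mod_def)
  qed (use eq assms in \<open>auto simp: blocker_mod_def\<close>)
qed

text \<open>If \<open>r\<close> saw every point of \<open>P\<close> alone on its line, each would be
  extreme by \<open>unmatched_extreme\<close>, but among three points the middle one in angular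
  order is not.\<close>

lemma R_matched:
  assumes "r \<in> R" shows "\<exists>i j. i < j \<and> j < n \<and> r = blocker_mod (i + j)"
proof -
  have "\<exists>i\<in>P. line_class P r i \<noteq> {i}"
  proof (rule ccontr)
    assume "\<not> (\<exists>i\<in>P. line_class P r i \<noteq> {i})"
    then have un: "line_class P r i = {i}" if "i \<in> P" for i using that by blast
    obtain \<phi> :: "real ^ 2 \<Rightarrow> real" where \<phi>:
      "\<And>p k. p \<in> P \<Longrightarrow> k \<in> P \<Longrightarrow> det3 r p k > 0 \<longleftrightarrow> \<phi> k < \<phi> p"
      "\<And>p k. p \<in> P \<Longrightarrow> k \<in> P \<Longrightarrow> det3 r p k < 0 \<longleftrightarrow> \<phi> p < \<phi> k"
      "\<And>p k. p \<in> P \<Longrightarrow> k \<in> P \<Longrightarrow> det3 r p k = 0 \<longleftrightarrow> \<phi> p = \<phi> k"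
      using angular_key[OF assms] by blast
    have ne: "\<phi> x \<noteq> \<phi> y" if "x \<in> P" "y \<in> P" "x \<noteq> y" for x y
      using \<phi>(3)[OF that(1,2)] un[OF that(1)] that by (auto simp: line_class_def)
    have False if "x \<in> P" "y \<in> P" "z \<in> P" "\<phi> x < \<phi> y" "\<phi> y < \<phi> z" for x y z
    proof -
      obtain s where s: "\<And>k. k \<in> P - {y} \<Longrightarrow> s * det3 r y k > 0"
        using unmatched_extreme[OF assms \<open>y \<in> P\<close> un[OF \<open>y \<in> P\<close>]] by blast
      have "s * det3 r y x > 0" "s * det3 r y z > 0" using s that by auto
      moreover have "det3 r y x > 0" "det3 r y z < 0" using \<phi> that by auto
      ultimately show False by (auto simp: zero_less_mult_iff)
    qed
    note no = this
    have P3: "p 0 \<in> P" "p 1 \<in> P" "p 2 \<in> P" "p 0 \<noteq> p 1" "p 0 \<noteq> p 2" "p 1 \<noteq> p 2"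
      using p_in p_eq n3 by auto
    have "\<phi> (p 0) \<noteq> \<phi> (p 1)" "\<phi> (p 0) \<noteq> \<phi> (p 2)" "\<phi> (p 1) \<noteq> \<phi> (p 2)"
      using ne P3 by auto
    then show False
      using no[of "p 0" "p 1" "p 2"] no[of "p 0" "p 2" "p 1"] no[of "p 1" "p 0" "p 2"]
        no[of "p 1" "p 2" "p 0"] no[of "p 2" "p 0" "p 1"] no[of "p 2" "p 1" "p 0"] P3 by linarith
  qed
  then obtain x where x: "x \<in> P" "line_class P r x \<noteq> {x}" by blast
  then obtain y where y: "y \<in> P" "y \<noteq> x" "det3 r x y = 0"
    using line_class_self[OF x(1)] unfolding line_class_def by blast
  obtain a b where ab: "a < n" "x = p a" "b < n" "y = p b" using p_surj x(1) y(1) by meson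
  have "a \<noteq> b" using y(2) ab by auto
  then consider "a < b" | "b < a" by linarith
  then show ?thesis
  proof cases
    case 1
    have "blocker a b = r"
      by (rule blocker_eqI[OF 1 ab(3) assms]) (use det3_eq_0_perm[OF y(3)] ab in auto)
    then show ?thesis using blocker_eq_mod[OF 1 ab(3)] 1 ab by blast
  next
    case 2
    have "blocker b a = r"
      by (rule blocker_eqI[OF 2 ab(1) assms]) (use det3_eq_0_perm[OF y(3)] ab in auto)
    then show ?thesis using blocker_eq_mod[OF 2 ab(1)] 2 ab by blast
  qed
qed

end

text \<open>The points of \<open>P\<close> and \<open>R\<close> carry the incidences of a cyclic subgroup of a cubic.\<close>
lemma cyclic_structure:
  obtains p q :: "nat \<Rightarrow> real ^ 2" where
    "\<And>i. p i \<in> P" "\<And>i. q i \<in> R" "\<And>i. p (i mod n) = p i" "\<And>i. q (i mod n) = q i"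
    "\<And>i j. p i = p j \<longleftrightarrow> i mod n = j mod n"
    "\<And>i j. i mod n \<noteq> j mod n \<Longrightarrow> det3 (p i) (p j) (q (i + j)) = 0"
    "P \<subseteq> range p" "R \<subseteq> range q"
proof -
  obtain p0 where p0: "bij_betw p0 {..<n} P"
    "\<And>i j k. i < j \<Longrightarrow> j < k \<Longrightarrow> k < n \<Longrightarrow> det3 (p0 i) (p0 j) (p0 k) > 0"
    using convex_enumeration by blast
  define p where "p i = p0 (i mod n)" for i
  define qq where "qq = blocker_mod p0"
  have n0: "n > 0" using n3 by simp
  have q_mod: "qq (i mod n) = qq i" for i by (simp add: qq_def blocker_mod_def[OF p0])
  have coll: "det3 (p0 i) (p0 j) (qq (i + j)) = 0 \<and> qq (i + j) \<in> R" if "i < j" "j < n" for i j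
    using blocker[OF p0 that] blocker_eq_mod[OF p0 that] by (simp add: qq_def)
  have coll': "det3 (p0 i) (p0 j) (qq (i + j)) = 0" if "i \<noteq> j" "i < n" "j < n" for i j
    using coll[of i j] coll[of j i] that det3_eq_0_perm(2)[of "p0 j" "p0 i"] by (metis add.commute nat_neq_iff)
  show thesis
  proof (rule that[of p qq])
    show "p i \<in> P" for i using p_in[OF p0] n0 by (simp add: p_def)
    show "p (i mod n) = p i" "qq (i mod n) = qq i" for i using q_mod by (auto simp: p_def)
    show "p i = p j \<longleftrightarrow> i mod n = j mod n" for i j
      using p_eq[OF p0] n0 by (simp add: p_def)
    show "det3 (p i) (p j) (qq (i + j)) = 0" if "i mod n \<noteq> j mod n" for i j
      using coll'[OF that] n0 q_mod[of "i mod n + j mod n"] q_mod[of "i + j"] by (simp add: p_def mod_add_eq)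
    show "P \<subseteq> range p"
    proof
      fix x assume "x \<in> P"
      then obtain i where "i < n" "x = p0 i" using p_surj[OF p0] by blast
      then show "x \<in> range p" by (intro image_eqI[of _ _ i]) (simp_all add: p_def)
    qed
    show "R \<subseteq> range qq" using R_matched[OF p0] by (force simp: qq_def)
    show "qq i \<in> R" for i
    proof -
      define s where "s = i mod n"
      have s: "s < n" using n0 by (simp add: s_def)
      have "qq s \<in> R"
      proof (cases "s = 0")
        case True
        have "qq (1 + (n - 1)) \<in> R" using coll[of 1 "n - 1"] n3 by auto
        then show ?thesis using q_mod[of n] True n3 by simp
      next
        case False
        then show ?thesis using coll[of 0 s] s by simp
      qed
      then show ?thesis using q_mod by (simp add: s_def)
    qed
  qed
qed

end

subsection \<open>Propagating the cubic\<close>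

lemma mod_shift_neq:
  fixes i j k n :: nat
  assumes "i \<noteq> j" "i < n" "j < n" shows "(k + i) mod n \<noteq> (k + j) mod n"
proof -
  have "(k + i) mod n \<noteq> (k + j) mod n" if "i < j" "j < n" for i j
  proof
    assume "(k + i) mod n = (k + j) mod n"
    then have "n dvd (k + j) - (k + i)" using that by (metis mod_eq_dvd_iff_nat add_le_cancel_left less_imp_le)
    then have "n dvd j - i" by simp
    then show False using that dvd_imp_le[of n "j - i"] by simp
  qed
  then show ?thesis using assms by (metis nat_neq_iff)
qed

lemma (in blocked_set) on_cubic:
  assumes n5: "n \<ge> 5"
  shows "\<exists>f. f \<noteq> 0 \<and> total_degree_le f 3 \<and> (\<forall>v\<in>P \<union> R. eval2 f v = 0)"
proof -
  obtain p q :: "nat \<Rightarrow> real ^ 2" where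
    pP: "\<And>i. p i \<in> P" and qR: "\<And>i. q i \<in> R" and p_mod: "\<And>i. p (i mod n) = p i"
    and q_mod: "\<And>i. q (i mod n) = q i"
    and p_eq: "\<And>i j. p i = p j \<longleftrightarrow> i mod n = j mod n"
    and coll: "\<And>i j. i mod n \<noteq> j mod n \<Longrightarrow> det3 (p i) (p j) (q (i + j)) = 0"
    and surj: "P \<subseteq> range p" "R \<subseteq> range q"
    using cyclic_structure by blast
  have qP: "q i \<notin> P" for i using R_notin[OF qR] .
  have pq: "q j \<noteq> p i" for i j using pP qP by metis
  show ?thesis
  proof (cases "n = 5")
    \<comment> \<open>No six indices are distinct modulo five, so \<open>pentagon_cubic\<close>
      takes the place of the hexagons and supplies the one point missing from the nine.\<close>
    case True
    have "card {p 0, p 1, p 2, p 3, p 4, q 0, q 1, q 2, q 3} \<le> 9"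
      using card_length[of "[p 0, p 1, p 2, p 3, p 4, q 0, q 1, q 2, q 3]"] by simp
    then obtain f where f: "f \<noteq> 0" "total_degree_le f 3"
      "\<And>v. v \<in> {p 0, p 1, p 2, p 3, p 4, q 0, q 1, q 2, q 3} \<Longrightarrow> eval2 f v = 0"
      using cubic_through_nine_points[of "{p 0, p 1, p 2, p 3, p 4, q 0, q 1, q 2, q 3}"] by blast
    have c: "det3 (p i) (p j) (q s) = 0" if "i \<noteq> j" "i < 5" "j < 5" "(i + j) mod 5 = s" for i j s
      using coll[of i j] q_mod[of "i + j"] that True by simp
    have "distinct [p 0, p 1, p 2, p 3, p 4]" using True by (simp add: p_eq)
    then have "eval2 f (q 4) = 0"
      by (rule pentagon_cubic[OF polyfun_total_degree[OF f(2)] gp, rotated, where ?r0.0 = "q 0"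
          and ?r1.0 = "q 1" and ?r2.0 = "q 2" and ?r3.0 = "q 3"])
        (use f(3) pP in \<open>simp_all add: qP c\<close>)
    then have fq: "eval2 f (q i) = 0" "eval2 f (p i) = 0" if "i < 5" for i
      using f(3) that by (auto simp: less_Suc_eq numeral_eq_Suc)
    have "eval2 f v = 0" if "v \<in> P \<union> R" for v
      using that surj fq[of "_ mod 5"] p_mod q_mod True by (metis Un_iff imageE mod_less_divisor subsetD zero_less_numeral)
    then show ?thesis using f by blast
  next
    case False
    then have n6: "n \<ge> 6" using n5 by simp
    have "card {p 0, p 1, p 2, p 3, p 4, p 5, q 3, q 4, q 5} \<le> 9"
      using card_length[of "[p 0, p 1, p 2, p 3, p 4, p 5, q 3, q 4, q 5]"] by simp
    then obtain f where f: "f \<noteq> 0" "total_degree_le f 3"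
      "\<And>v. v \<in> {p 0, p 1, p 2, p 3, p 4, p 5, q 3, q 4, q 5} \<Longrightarrow> eval2 f v = 0"
      using cubic_through_nine_points[of "{p 0, p 1, p 2, p 3, p 4, p 5, q 3, q 4, q 5}"] by blast
    define F where "F = eval2 f"
    have polyF: "polyfun 3 F" unfolding F_def by (rule polyfun_total_degree[OF f(2)])
    \<comment> \<open>Opposite sides have equal index sums \<open>s1\<close>, \<open>s2\<close>,
      \<open>s3\<close>. Shifting all vertices by \<open>k\<close> shifts the sums by
      \<open>2 * k\<close>, so one choice of offsets serves for every \<open>k\<close>.\<close>
    have hexagon: "F (p (k + i5)) = 0 \<and> F (p (k + i6)) = 0 \<and> F (q (2 * k + s3)) = 0"
      if i: "distinct [i1, i2, i3, i4, i5, i6]" "\<forall>i\<in>set [i1, i2, i3, i4, i5, i6]. i < n"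
        and s: "i1 + i2 = s1" "i4 + i5 = s1" "i3 + i4 = s2" "i6 + i1 = s2" "i2 + i3 = s3" "i5 + i6 = s3"
        and zero: "F (p (k + i1)) = 0" "F (p (k + i2)) = 0" "F (p (k + i3)) = 0" "F (p (k + i4)) = 0"
          "F (q (2 * k + s1)) = 0" "F (q (2 * k + s2)) = 0"
        and uv: "F (p (k + i5)) = 0" "F (p (k + i6)) = 0 \<or> F (q (2 * k + s3)) = 0"
      for k i1 i2 i3 i4 i5 i6 s1 s2 s3
    proof -
      note ne = mod_shift_neq
      have c: "det3 (p (k + i)) (p (k + j)) (q (2 * k + s)) = 0" if "i \<noteq> j" "i < n" "j < n" "i + j = s" for i j s
      proof -
        have "k + i + (k + j) = 2 * k + s" using that(4) by simp
        then show ?thesis using coll[OF ne[OF that(1-3), of k]] by (simp only:)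
      qed
      obtain v where v: "v \<in> {p (k + i6), q (2 * k + s3)}" "F v = 0" using uv(2) by blast
      have "v \<noteq> p (k + i5)"
        using v(1) i ne[of i5 i6 n k] by (auto simp: p_eq pq pq[symmetric])
      have lt: "i1 < n" "i2 < n" "i3 < n" "i4 < n" "i5 < n" "i6 < n" using i(2) by simp_all
      show ?thesis
      proof (rule hexagon_cubic[OF polyF gp, where ?h1.0 = "p (k + i1)" and ?h2.0 = "p (k + i2)"
            and ?h3.0 = "p (k + i3)" and ?h4.0 = "p (k + i4)" and ?r1.0 = "q (2 * k + s1)"
            and ?r2.0 = "q (2 * k + s2)" and u = "p (k + i5)" and v = v])
        show "distinct [p (k + i1), p (k + i2), p (k + i3), p (k + i4), p (k + i5), p (k + i6)]"
          using i(1) ne lt by (simp add: p_eq)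
        show "det3 (p (k + i1)) (p (k + i2)) (q (2 * k + s1)) = 0"
          "det3 (p (k + i4)) (p (k + i5)) (q (2 * k + s1)) = 0"
          "det3 (p (k + i2)) (p (k + i3)) (q (2 * k + s3)) = 0"
          "det3 (p (k + i5)) (p (k + i6)) (q (2 * k + s3)) = 0"
          "det3 (p (k + i3)) (p (k + i4)) (q (2 * k + s2)) = 0"
          "det3 (p (k + i6)) (p (k + i1)) (q (2 * k + s2)) = 0"
          using i(1) by (intro c lt s; force)+
        show "v \<in> {p (k + i5), p (k + i6), q (2 * k + s3)}" using v(1) by blast
        show "p (k + i5) \<noteq> v" using \<open>v \<noteq> p (k + i5)\<close> by simp
      qed (use pP qP zero uv(1) v(2) in simp_all)
    qed
    have lt: "0 < n" "1 < n" "2 < n" "3 < n" "4 < n" "5 < n" using n6 by auto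
    have next_q6: "F (q (2 * k + 6)) = 0"
      if "\<And>i. i < 6 \<Longrightarrow> F (p (k + i)) = 0" "F (q (2 * k + 4)) = 0" "F (q (2 * k + 5)) = 0" for k
      using hexagon[of 0 4 2 3 1 5 4 5 6 k] that(2,3) that(1)[of 0] that(1)[of 1] that(1)[of 2] that(1)[of 3] that(1)[of 4]
        that(1)[of 5] lt by simp
    have next_q7: "F (q (2 * k + 7)) = 0"
      if "\<And>i. i < 6 \<Longrightarrow> F (p (k + i)) = 0" "F (q (2 * k + 3)) = 0" "F (q (2 * k + 5)) = 0" for k
      using hexagon[of 0 3 4 1 2 5 3 5 7 k] that(2,3) that(1)[of 0] that(1)[of 1] that(1)[of 2] that(1)[of 3] that(1)[of 4]
        that(1)[of 5] lt by simp
    have next_p: "F (p (k + 6)) = 0"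
      if "\<And>i. i < 6 \<Longrightarrow> F (p (k + i)) = 0" "F (q (2 * k + 3)) = 0" "F (q (2 * k + 6)) = 0"
        "F (q (2 * k + 7)) = 0" for k
    \<comment> \<open>The hexagon below uses the offsets \<open>0\<close> and \<open>6\<close>,
      which are the same vertex when \<open>n = 6\<close>; in that case the new point is an old
      one.\<close>
    proof (cases "n = 6")
      case True
      then have "p (k + 6) = p k" by (simp add: p_eq)
      then show ?thesis using that(1)[of 0] by simp
    next
      case False
      then have "6 < n" using n6 by simp
      then show ?thesis using hexagon[of 0 3 4 2 1 6 3 6 7 k] that(2-4) that(1)[of 0] that(1)[of 1] that(1)[of 2] that(1)[of 3]
          that(1)[of 4] lt by simp
    qed
    \<comment> \<open>A sliding window: six consecutive points of \<open>P\<close> and the blocking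
      points of index sums \<open>2 * k + 3\<close> to \<open>2 * k + 7\<close>. From
      \<open>k\<close> to \<open>k + 1\<close> three of these sums remain; \<open>next_p\<close>
      adds a vertex, then \<open>next_q6\<close> and \<open>next_q7\<close> add the two new
      sums.\<close>
    have inv: "(\<forall>i<6. F (p (k + i)) = 0) \<and> (\<forall>i\<in>{3..7}. F (q (2 * k + i)) = 0)" for k
    proof (induction k)
      case 0
      have P: "F (p (0 + i)) = 0" if "i < 6" for i
        using f(3) that by (auto simp: F_def less_Suc_eq numeral_eq_Suc)
      have Q: "F (q (2 * 0 + 3)) = 0" "F (q (2 * 0 + 4)) = 0" "F (q (2 * 0 + 5)) = 0"
        using f(3) by (simp_all add: F_def)
      have "F (q (2 * 0 + i)) = 0" if "i \<in> {3..7}" for i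
      proof -
        have "i = 3 \<or> i = 4 \<or> i = 5 \<or> i = 6 \<or> i = 7" using that by auto
        then show ?thesis using Q next_q6[OF P Q(2,3)] next_q7[OF P Q(1,3)] by metis
      qed
      then show ?case using P by blast
    next
      case (Suc k)
      have Q: "F (q (2 * k + 3)) = 0" "F (q (2 * k + 5)) = 0" "F (q (2 * k + 6)) = 0" "F (q (2 * k + 7)) = 0"
        using Suc by simp_all
      have "F (p (k + 6)) = 0" using next_p[of k] Suc Q by simp
      have P: "F (p (Suc k + i)) = 0" if "i < 6" for i
      proof (cases "i = 5")
        case True
        then show ?thesis using \<open>F (p (k + 6)) = 0\<close> by (simp add: add.commute)
      next
        case False
        then have "Suc i < 6" using that by simp
        then have "F (p (k + Suc i)) = 0" using Suc by blast
        then show ?thesis by simp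
      qed
      have Q': "F (q (2 * Suc k + 3)) = 0" "F (q (2 * Suc k + 4)) = 0" "F (q (2 * Suc k + 5)) = 0"
        using Q by (simp_all add: algebra_simps)
      have "F (q (2 * Suc k + i)) = 0" if "i \<in> {3..7}" for i
      proof -
        have "i = 3 \<or> i = 4 \<or> i = 5 \<or> i = 6 \<or> i = 7" using that by auto
        then show ?thesis using Q' next_q6[OF P Q'(2,3)] next_q7[OF P Q'(1,3)] by metis
      qed
      then show ?case using P by blast
    qed
    have Fp: "F (p i) = 0" for i using inv[of i] by (metis add_0_right zero_less_numeral)
    have Fq3: "F (q j) = 0" if "j \<ge> 3" for j
    proof -
      have "j = 2 * ((j - 3) div 2) + (3 + (j - 3) mod 2)"
        using that by presburger
      moreover have "3 + (j - 3) mod 2 \<in> {3..7}" by (auto intro: order_trans[of _ "3 + 1"])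
      ultimately show ?thesis using inv[of "(j - 3) div 2"] by metis
    qed
    have Fq: "F (q j) = 0" for j
    proof -
      \<comment> \<open>The windows start at sum three; smaller sums are reached by adding the
        period \<open>n\<close>.\<close>
      have "q (j + n) = q j" using q_mod[of j] q_mod[of "j + n"] by simp
      then show ?thesis using Fq3[of "j + n"] n6 by simp
    qed
    have "eval2 f v = 0" if "v \<in> P \<union> R" for v
      using that surj Fp Fq unfolding F_def by blast
    then show ?thesis using f by blast
  qed
qed

text \<open>With affine weights \<open>u\<close> and \<open>v\<close> of \<open>r\<close>, being
  outside the segment means \<open>u * v < 0\<close>, and the inner product is
  \<open>- (u * v)\<close> times the squared length.\<close>

lemma outside_segment:
  fixes x y r :: "real ^ 2"
  assumes "x \<noteq> y" "r \<in> affine hull {x, y}" "r \<notin> closed_segment x y"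
  shows "det3 x y r = 0 \<and> (x - r) \<bullet> (y - r) > 0"
proof -
  obtain u v where uv: "u + v = 1" "r = u *\<^sub>R x + v *\<^sub>R y"
    using assms(2) unfolding affine_hull_2 by blast
  have v: "v = 1 - u" using uv(1) by simp
  have "\<not> (0 \<le> v \<and> v \<le> 1)"
    using assms(3) uv unfolding in_segment by (metis add_diff_cancel_right')
  then have "u * v < 0" using v by (auto simp: mult_less_0_iff not_le)
  moreover have "(x - y) \<bullet> (x - y) > 0" using assms(1) by simp
  moreover have "(x - r) \<bullet> (y - r) = - (u * v) * ((x - y) \<bullet> (x - y))"
    unfolding uv(2) v by (simp add: inner2 algebra_simps)
  ultimately have "(x - r) \<bullet> (y - r) > 0" by (simp add: mult_neg_pos)
  moreover have "det3 x y r = 0"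
    unfolding uv(2) v by (simp add: det3_alt algebra_simps)
  ultimately show ?thesis by simp
qed

theorem theorem1p3:
  fixes n :: nat and P R :: "(real ^ 2) set"
  assumes "n > 0"
    and "finite P" and "card P = n" and "general_position P"
    and "finite R" and "card R = n" and "P \<inter> R = {}"
    and "\<And>x y. x \<in> P \<Longrightarrow> y \<in> P \<Longrightarrow> x \<noteq> y \<Longrightarrow>
           \<exists>r\<in>R. r \<in> affine hull {x, y} \<and> r \<notin> closed_segment x y"
  shows "\<exists>C. cubic_curve C \<and> P \<union> R \<subseteq> C"
proof -
  have "\<exists>f. f \<noteq> 0 \<and> total_degree_le f 3 \<and> (\<forall>v\<in>P \<union> R. eval2 f v = 0)"
  proof (cases "n \<ge> 5")
    case True
    interpret blocked_set P R n
    proof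
      show "gp3 P" using assms(4) by (rule general_position_gp3)
      show "3 \<le> n" using True by simp
      show "\<exists>r\<in>R. det3 x y r = 0 \<and> (x - r) \<bullet> (y - r) > 0" if "x \<in> P" "y \<in> P" "x \<noteq> y" for x y
        using assms(8)[OF that] outside_segment[OF that(3)] by blast
    qed (use assms in auto)
    show ?thesis by (rule on_cubic[OF True])
  next
    \<comment> \<open>For \<open>n\<close> at most four the union has at most eight points, and a
      cubic passes through any nine.\<close>
    case False
    then have "card (P \<union> R) \<le> 9" using card_Un_le[of P R] assms(3,6) by simp
    then obtain f where "f \<noteq> 0" "total_degree_le f 3" "\<And>v. v \<in> P \<union> R \<Longrightarrow> eval2 f v = 0"
      using cubic_through_nine_points[of "P \<union> R"] assms(2,5) by blast
    then show ?thesis by blast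
  qed
  then obtain f where f: "f \<noteq> 0" "total_degree_le f 3" "\<forall>v\<in>P \<union> R. eval2 f v = 0" by blast
  have "cubic_curve {v. eval2 f v = 0}" using f unfolding cubic_curve_def by blast
  then show ?thesis using f(3) by blast
qed

end
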